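(* Let $(u(x-ct,y),v(x-ct,y))$, with profile $(u,v)\in C^2(D_L^\infty)$ and wave speed $c\in\mathbb R$, be a genuine traveling-wave solution of the $\beta$-plane equation ($\beta\ge 0$) in the unbounded channel $D_L^\infty=\mathbb T_L\times\mathbb R$ with $v\to0$ as $y\to\pm\infty$ for $x\in\mathbb T_L$. Assume that $|\partial_yu|\ge C_0$ on $D_L^\infty$ for some $C_0>0$, that $\partial_xv,\partial_yv\in L^\infty(D_L^\infty)$, and that $\frac{v^2\partial_yu}{u}\to0$ as $y\to\pm\infty$ for $x\in\mathbb T_L$. Then $c$ is a generalized inflection value of $u$, i.e. $\{\beta-\Delta u=0\}\cap\{u=c\}\neq\emptyset$.
   Context: Let $L>0$, $\mathbb T_L=\mathbb R/L\mathbb Z$, $D_L^\infty=\mathbb T_L\times(-\infty,\infty)$. For a constant $\beta\ge0$, the $\beta$-plane equation on $D_L^\infty$ is $$u_t+uu_x+vu_y-\beta yv=-P_x,\quad v_t+uv_x+vv_y+\beta yu=-P_y,\quad u_x+v_y=0$$ ($P$ is the pressure), with the asymptotic condition $v\to0$ as $y\to\pm\infty$ for $x\in\mathbb T_L$. A traveling-wave solution of speed $c\in\mathbb R$ is a solution (for some pressure) of the form $(u(x-ct,y),v(x-ct,y))$, with profiles $u,v$ defined on $D_L^\infty$ ($L$-periodic in the first variable). It is a shear flow if $v\equiv0$ on $D_L^\infty$, and genuine if it is not a shear flow. $\Delta=\partial_x^2+\partial_y^2$. *)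

theory Defs
  imports "HOL-Analysis.Analysis" "HOL-Library.Periodic_Fun"
begin

text \<open>
  Functions on the channel \<open>\<T>\<^sub>L \<times> \<real>\<close> are functions on the plane, points being pairs \<open>(x, y)\<close>,
  that are \<open>L\<close>-periodic in the first coordinate.
\<close>

definition x_periodic :: "real \<Rightarrow> (real \<times> real \<Rightarrow> 'b) \<Rightarrow> bool" where
  "x_periodic L f \<longleftrightarrow> (\<forall>y. periodic_fun_simple (\<lambda>x. f (x, y)) L)"

definition partial_x :: "(real \<times> real \<Rightarrow> real) \<Rightarrow> real \<times> real \<Rightarrow> real" where
  "partial_x f = (\<lambda>(x, y). deriv (\<lambda>s. f (s, y)) x)"

definition partial_y :: "(real \<times> real \<Rightarrow> real) \<Rightarrow> real \<times> real \<Rightarrow> real" where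
  "partial_y f = (\<lambda>(x, y). deriv (\<lambda>s. f (x, s)) y)"

text \<open>\<open>deriv\<close> is unspecified where the derivative does not exist, so existence is required separately.\<close>

definition has_partials :: "(real \<times> real \<Rightarrow> real) \<Rightarrow> bool" where
  "has_partials f \<longleftrightarrow>
     (\<forall>x y. (\<lambda>s. f (s, y)) differentiable (at x) \<and> (\<lambda>s. f (x, s)) differentiable (at y))"

definition C1_plane :: "(real \<times> real \<Rightarrow> real) \<Rightarrow> bool" where
  "C1_plane f \<longleftrightarrow> has_partials f \<and>
     continuous_on UNIV (partial_x f) \<and> continuous_on UNIV (partial_y f)"

definition C2_plane :: "(real \<times> real \<Rightarrow> real) \<Rightarrow> bool" where
  "C2_plane f \<longleftrightarrow> C1_plane f \<and> C1_plane (partial_x f) \<and> C1_plane (partial_y f)"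

definition C2_channel :: "real \<Rightarrow> (real \<times> real \<Rightarrow> real) \<Rightarrow> bool" where
  "C2_channel L f \<longleftrightarrow> x_periodic L f \<and> C2_plane f"

definition laplacian :: "(real \<times> real \<Rightarrow> real) \<Rightarrow> real \<times> real \<Rightarrow> real" where
  "laplacian f p = partial_x (partial_x f) p + partial_y (partial_y f) p"

text \<open>
  Classical solutions, for all times \<open>t\<close>, of the \<open>\<beta>\<close>-plane equation. The first argument of
  \<open>U\<close>, \<open>V\<close>, \<open>P\<close> is time. The pressure, too, is a function on the channel, hence periodic in \<open>x\<close>.
  The asymptotic condition on \<open>V\<close> is not part of this predicate.
\<close>

definition beta_plane_solution ::
  "real \<Rightarrow> real \<Rightarrow> (real \<Rightarrow> real \<times> real \<Rightarrow> real) \<Rightarrow> (real \<Rightarrow> real \<times> real \<Rightarrow> real) \<Rightarrow>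
   (real \<Rightarrow> real \<times> real \<Rightarrow> real) \<Rightarrow> bool" where
  "beta_plane_solution L \<beta> U V P \<longleftrightarrow>
     (\<forall>t. x_periodic L (U t) \<and> x_periodic L (V t) \<and> x_periodic L (P t)) \<and>
     (\<forall>t. has_partials (U t) \<and> has_partials (V t) \<and> has_partials (P t)) \<and>
     (\<forall>t p. (\<lambda>s. U s p) differentiable (at t) \<and> (\<lambda>s. V s p) differentiable (at t)) \<and>
     (\<forall>t x y.
        deriv (\<lambda>s. U s (x, y)) t + U t (x, y) * partial_x (U t) (x, y)
          + V t (x, y) * partial_y (U t) (x, y) - \<beta> * y * V t (x, y)
          = - partial_x (P t) (x, y) \<and>
        deriv (\<lambda>s. V s (x, y)) t + U t (x, y) * partial_x (V t) (x, y)
          + V t (x, y) * partial_y (V t) (x, y) + \<beta> * y * U t (x, y)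
          = - partial_y (P t) (x, y) \<and>
        partial_x (U t) (x, y) + partial_y (V t) (x, y) = 0)"

definition traveling_wave_solution ::
  "real \<Rightarrow> real \<Rightarrow> real \<Rightarrow> (real \<times> real \<Rightarrow> real) \<Rightarrow> (real \<times> real \<Rightarrow> real) \<Rightarrow> bool" where
  "traveling_wave_solution L \<beta> c u v \<longleftrightarrow>
     (\<exists>P. beta_plane_solution L \<beta> (\<lambda>t (x, y). u (x - c * t, y)) (\<lambda>t (x, y). v (x - c * t, y)) P)"

text \<open>The notion depends only on the second velocity component.\<close>

definition shear_flow :: "(real \<times> real \<Rightarrow> real) \<Rightarrow> bool" where
  "shear_flow v \<longleftrightarrow> (\<forall>p. v p = 0)"

text \<open>Limits as \<open>y \<rightarrow> \<plusminus>\<infinity>\<close> are taken pointwise in \<open>x\<close>.\<close>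

definition vanishes_at_ends :: "(real \<times> real \<Rightarrow> real) \<Rightarrow> bool" where
  "vanishes_at_ends f \<longleftrightarrow>
     (\<forall>x. ((\<lambda>y. f (x, y)) \<longlongrightarrow> 0) at_top \<and> ((\<lambda>y. f (x, y)) \<longlongrightarrow> 0) at_bot)"

definition generalized_inflection_value :: "real \<Rightarrow> (real \<times> real \<Rightarrow> real) \<Rightarrow> real \<Rightarrow> bool" where
  "generalized_inflection_value \<beta> u c \<longleftrightarrow>
     {p. \<beta> - laplacian u p = 0} \<inter> {p. u p = c} \<noteq> {}"

end

theory Submission
  imports Defs
begin

text \<open>
  The curl of the momentum equations is \<open>(u - c) \<Delta>v + v (\<beta> - \<Delta>u) = 0\<close>. If \<open>\<beta> - \<Delta>u\<close> has no zero on
  the level set \<open>u = c\<close>, then \<open>v = 0\<close> there. After a reflection in \<open>y\<close>, \<open>u\<close> increases in \<open>y\<close>. Below the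
  level set the \<open>\<beta>\<close>-term in the energy identity for \<open>v / (u - c)\<close> has the favourable sign, so that
  \<open>v = 0\<close> there. Hence the flow below is a shear flow and the level set is a line \<open>y = g\<close>. Above it the
  sign is unfavourable, but \<open>v\<close> has vanishing Cauchy data on \<open>y = g\<close> and \<open>\<bar>\<Delta>v\<bar> \<le> K \<bar>v\<bar> / (y - g)\<close>
  locally. Such a potential is absorbed by a Carleman estimate through Hardy's inequality, so \<open>v = 0\<close>
  propagates upwards in steps of fixed height.
\<close>

subsection \<open>Functions with continuous partial derivatives\<close>

text \<open>The sign of the \<beta>-term is that of u - c, so the energy argument can decide one
  side only. It needs v / (u - c) to stay bounded up to the level set; this comes from the bound on
  v_y together with the lower bound on u_y. That the critical level is a straight line matters for
  the other side: both the Carleman weight and Hardy's inequality may then depend on y alone.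
  Hardy's inequality turns a potential of size K / (y - g) into 4 K^2 times the integral of w_y^2,
  which a term with the large factor \<tau> absorbs. As K only decides how large \<tau> must be, the
  height gained in a step does not depend on K, and the steps reach every y.\<close>

definition has_grad ::
  "(real \<times> real \<Rightarrow> real) \<Rightarrow> (real \<times> real \<Rightarrow> real) \<Rightarrow> (real \<times> real \<Rightarrow> real) \<Rightarrow> bool" where
  "has_grad f fx fy \<longleftrightarrow> (\<forall>x y.
     ((\<lambda>s. f (s, y)) has_real_derivative fx (x, y)) (at x) \<and>
     ((\<lambda>s. f (x, s)) has_real_derivative fy (x, y)) (at y))"

lemma has_gradI:
  assumes "\<And>x y. ((\<lambda>s. f (s, y)) has_real_derivative fx (x, y)) (at x)"
    and "\<And>x y. ((\<lambda>s. f (x, s)) has_real_derivative fy (x, y)) (at y)"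
  shows "has_grad f fx fy"
  using assms by (simp add: has_grad_def)

lemma has_gradD:
  assumes "has_grad f fx fy"
  shows "((\<lambda>s. f (s, y)) has_real_derivative fx (x, y)) (at x)"
    and "((\<lambda>s. f (x, s)) has_real_derivative fy (x, y)) (at y)"
  using assms by (auto simp: has_grad_def)

lemma partials_eqI:
  assumes "has_grad f fx fy"
  shows "partial_x f = fx" "partial_y f = fy"
  using has_gradD[OF assms] by (auto simp: partial_x_def partial_y_def DERIV_imp_deriv)

lemma has_partials_iff: "has_partials f \<longleftrightarrow> has_grad f (partial_x f) (partial_y f)"
  unfolding has_partials_def has_grad_def partial_x_def partial_y_def
  by (auto simp: DERIV_deriv_iff_real_differentiable)

lemma has_grad_minus: "has_grad f fx fy \<Longrightarrow> has_grad (\<lambda>p. - f p) (\<lambda>p. - fx p) (\<lambda>p. - fy p)"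
  unfolding has_grad_def by (auto intro!: derivative_intros)

text \<open>Separate differentiability alone does not imply continuity. One continuous partial makes
  f totally differentiable at every point, which supplies the joint continuity behind all box
  integrals.\<close>

lemma continuous_on_of_grad:
  assumes f: "has_grad f fx fy" and c: "continuous_on UNIV fy"
  shows "continuous_on UNIV f"
proof -
  have "isCont f (x, y)" for x y
  proof -
    have "((\<lambda>(x, y). f (x, y)) has_derivative
        (\<lambda>(tx, ty). fx (x, y) * tx + blinfun_scaleR_left (fy (x, y)) ty)) (at (x, y) within UNIV \<times> UNIV)"
    proof (rule has_derivative_partialsI[where fy="\<lambda>x y. blinfun_scaleR_left (fy (x, y))"])
      show "((\<lambda>x. f (x, y)) has_derivative (*) (fx (x, y))) (at x within UNIV)"
        using has_gradD(1)[OF f] by (simp add: has_field_derivative_def)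
      show "((\<lambda>y. f (x, y)) has_derivative blinfun_apply (blinfun_scaleR_left (fy (x, y)))) (at y within UNIV)" for x y
        using has_gradD(2)[OF f, of x y] by (simp add: has_field_derivative_def mult_commute_abs)
      have "isCont (\<lambda>p. blinfun_scaleR_left (fy p) :: real \<Rightarrow>\<^sub>L real) (x, y)"
        using c by (intro bounded_linear.isCont[OF bounded_linear_blinfun_scaleR_left])
          (simp add: continuous_on_eq_continuous_at)
      then show "continuous (at (x, y) within UNIV \<times> UNIV) (\<lambda>(x, y). blinfun_scaleR_left (fy (x, y)) :: real \<Rightarrow>\<^sub>L real)"
        by (simp add: case_prod_unfold)
    qed auto
    then show ?thesis
      by (auto simp: case_prod_unfold intro!: has_derivative_continuous)
  qed
  then show ?thesis by (simp add: continuous_on_eq_continuous_at)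
qed

lemma C1_planeD:
  assumes "C1_plane f"
  shows "has_grad f (partial_x f) (partial_y f)"
    and "continuous_on UNIV (partial_x f)" "continuous_on UNIV (partial_y f)"
  using assms by (auto simp: C1_plane_def has_partials_iff)

text \<open>Schwarz's theorem: the second difference over a small square is evaluated by the mean
  value theorem in both orders. The form suits a pressure whose second derivatives are known only
  through the momentum equations.\<close>

lemma mixed_partials_eq:
  assumes f: "has_grad f fx fy"
    and fx: "\<And>x y. ((\<lambda>s. fx (x, s)) has_real_derivative fxy (x, y)) (at y)"
    and fy: "\<And>x y. ((\<lambda>s. fy (s, y)) has_real_derivative fyx (x, y)) (at x)"
    and cxy: "continuous_on UNIV fxy" and cyx: "continuous_on UNIV fyx"
  shows "fxy = fyx"
proof (rule ext, rule ccontr)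
  fix p assume ne: "fxy p \<noteq> fyx p"
  obtain x y where p: "p = (x, y)" by force
  define e where "e = \<bar>fxy p - fyx p\<bar> / 2"
  have e: "e > 0" using ne by (simp add: e_def)
  obtain d1 where d1: "d1 > 0" "\<And>q. dist q p < d1 \<Longrightarrow> dist (fxy q) (fxy p) < e"
    using cxy e unfolding continuous_on_iff by (metis UNIV_I)
  obtain d2 where d2: "d2 > 0" "\<And>q. dist q p < d2 \<Longrightarrow> dist (fyx q) (fyx p) < e"
    using cyx e unfolding continuous_on_iff by (metis UNIV_I)
  define h where "h = min d1 d2 / 3"
  have h: "h > 0" using d1 d2 by (simp add: h_def)
  have close: "dist (a, b) p < d1" "dist (a, b) p < d2"
    if "x < a" "a < x + h" "y < b" "b < y + h" for a b
  proof -
    have "dist (a, b) p \<le> dist a x + dist b y"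
      unfolding p dist_Pair_Pair by (rule real_sqrt_sum_squares_triangle_ineq[of "dist a x" 0 0 "dist b y", simplified] order_trans)+ 
    also have "\<dots> < 2 * h" using that by (auto simp: dist_real_def)
    finally have "dist (a, b) p < 2 * h" .
    then show "dist (a, b) p < d1" "dist (a, b) p < d2" using d1(1) d2(1) by (auto simp: h_def)
  qed
  define D where "D = f (x + h, y + h) - f (x + h, y) - f (x, y + h) + f (x, y)"
  have "\<exists>a b. x < a \<and> a < x + h \<and> y < b \<and> b < y + h \<and> D = h * h * fxy (a, b)"
  proof -
    have "\<exists>a>x. a < x + h \<and> (f (x + h, y + h) - f (x + h, y)) - (f (x, y + h) - f (x, y))
        = (x + h - x) * (fx (a, y + h) - fx (a, y))"
      using h by (intro MVT2) (auto intro!: derivative_intros has_gradD[OF f])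
    then obtain a where a: "x < a" "a < x + h" "D = h * (fx (a, y + h) - fx (a, y))"
      by (auto simp: D_def)
    have "\<exists>b>y. b < y + h \<and> fx (a, y + h) - fx (a, y) = (y + h - y) * fxy (a, b)"
      using h by (intro MVT2) (auto intro!: fx)
    then show ?thesis using a by auto
  qed
  then obtain a b where ab: "x < a" "a < x + h" "y < b" "b < y + h" "D = h * h * fxy (a, b)" by blast
  have "\<exists>a b. x < a \<and> a < x + h \<and> y < b \<and> b < y + h \<and> D = h * h * fyx (a, b)"
  proof -
    have "\<exists>b>y. b < y + h \<and> (f (x + h, y + h) - f (x, y + h)) - (f (x + h, y) - f (x, y))
        = (y + h - y) * (fy (x + h, b) - fy (x, b))"
      using h by (intro MVT2) (auto intro!: derivative_intros has_gradD[OF f])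
    then obtain b where b: "y < b" "b < y + h" "D = h * (fy (x + h, b) - fy (x, b))"
      by (auto simp: D_def algebra_simps)
    have "\<exists>a>x. a < x + h \<and> fy (x + h, b) - fy (x, b) = (x + h - x) * fyx (a, b)"
      using h by (intro MVT2) (auto intro!: fy)
    then show ?thesis using b by auto
  qed
  then obtain a' b' where ab': "x < a'" "a' < x + h" "y < b'" "b' < y + h" "D = h * h * fyx (a', b')" by blast
  have "fxy (a, b) = fyx (a', b')" using ab(5) ab'(5) h by simp
  moreover have "\<bar>fxy (a, b) - fxy p\<bar> < e" using d1(2)[OF close(1)[OF ab(1-4)]] by (simp add: dist_real_def)
  moreover have "\<bar>fyx (a', b') - fyx p\<bar> < e" using d2(2)[OF close(2)[OF ab'(1-4)]] by (simp add: dist_real_def)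
  ultimately show False using ne unfolding e_def by argo
qed

lemma periodicD: "x_periodic L f \<Longrightarrow> f (x + L, y) = f (x, y)"
  unfolding x_periodic_def by (auto dest!: spec[of _ y] periodic_fun_simple.plus_period)

lemma x_periodicI: "(\<And>x y. f (x + L, y) = f (x, y)) \<Longrightarrow> x_periodic L f"
  unfolding x_periodic_def periodic_fun_simple_def by blast

lemma x_periodic_grad:
  assumes f: "has_grad f fx fy" and per: "x_periodic L f"
  shows "x_periodic L fx" "x_periodic L fy"
proof -
  have eq: "f (x + L, y) = f (x, y)" for x y using per by (rule periodicD)
  show "x_periodic L fx"
  proof (rule x_periodicI)
    fix x y
    have "((\<lambda>s. f (s + L, y)) has_real_derivative fx (x + L, y)) (at x)"
      using has_gradD(1)[OF f, of "y" "x + L"] by (simp add: DERIV_shift)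
    then show "fx (x + L, y) = fx (x, y)"
      using has_gradD(1)[OF f, of y x] DERIV_unique by (simp add: eq)
  qed
  show "x_periodic L fy"
  proof (rule x_periodicI)
    fix x y
    show "fy (x + L, y) = fy (x, y)"
      using has_gradD(2)[OF f, of "x + L" y] has_gradD(2)[OF f, of x y] DERIV_unique by (simp add: eq)
  qed
qed

lemma continuous_on_line:
  fixes f :: "real \<times> real \<Rightarrow> real"
  assumes "continuous_on UNIV f"
  shows "continuous_on S (\<lambda>s. f (s, y))" "continuous_on S (\<lambda>s. f (x, s))"
  by (auto intro!: continuous_on_compose2[OF assms] continuous_intros)

lemma eq_0_if_eq_0_left:
  fixes f :: "real \<times> real \<Rightarrow> real"
  assumes "continuous_on UNIV f" and "\<And>s. s < b \<Longrightarrow> f (x, s) = 0"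
  shows "f (x, b) = 0"
proof -
  have "((\<lambda>s. f (x, s)) \<longlongrightarrow> 0) (at_left b)"
    using assms(2) by (intro tendsto_eventually) (auto simp: eventually_at_filter)
  moreover have "((\<lambda>s. f (x, s)) \<longlongrightarrow> f (x, b)) (at_left b)"
    using continuous_on_line(2)[OF assms(1), of UNIV x]
    by (metis UNIV_I continuous_on tendsto_within_subset subset_UNIV)
  ultimately show ?thesis
    by (simp add: tendsto_unique[OF trivial_limit_at_left_real])
qed

lemma increment_ge:
  assumes f: "has_grad f fx fy" and fy: "\<And>p. k \<le> fy p" and "s \<le> t"
  shows "k * (t - s) \<le> f (x, t) - f (x, s)"
proof (cases "s = t")
  case False
  then have "\<exists>z>s. z < t \<and> f (x, t) - f (x, s) = (t - s) * fy (x, z)"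
    using \<open>s \<le> t\<close> by (intro MVT2 has_gradD[OF f]) auto
  then show ?thesis using fy \<open>s \<le> t\<close> mult_left_mono[of k _ "t - s"] by (auto simp: mult.commute)
qed simp

section \<open>Integration over boxes of one period\<close>

lemma integral_box_iterated:
  fixes f :: "real \<times> real \<Rightarrow> real"
  assumes "continuous_on UNIV f"
  shows "integral (cbox (x0, a) (x1, b)) f = integral {x0..x1} (\<lambda>x. integral {a..b} (\<lambda>y. f (x, y)))"
    and "integral (cbox (x0, a) (x1, b)) f = integral {a..b} (\<lambda>y. integral {x0..x1} (\<lambda>x. f (x, y)))"
proof -
  have c: "continuous_on (cbox (x0, a) (x1, b)) f" using assms continuous_on_subset by blast
  show 1: "integral (cbox (x0, a) (x1, b)) f = integral {x0..x1} (\<lambda>x. integral {a..b} (\<lambda>y. f (x, y)))"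
    using integral_prod_continuous[OF c] by simp
  show "integral (cbox (x0, a) (x1, b)) f = integral {a..b} (\<lambda>y. integral {x0..x1} (\<lambda>x. f (x, y)))"
    unfolding 1 using integral_swap_continuous[of x0 a x1 b "\<lambda>x y. f (x, y)"] c by simp
qed

lemma integrable_box:
  fixes f :: "real \<times> real \<Rightarrow> real"
  assumes "continuous_on UNIV f"
  shows "f integrable_on cbox p q"
  using assms continuous_on_subset integrable_continuous by blast

text \<open>Gauss' theorem on one period: the fluxes of \<open>X\<close> through the two vertical
  sides cancel.\<close>

lemma periodic_box_divergence:
  fixes X Y Xx Yy :: "real \<times> real \<Rightarrow> real"
  assumes X: "\<And>x y. ((\<lambda>s. X (s, y)) has_real_derivative Xx (x, y)) (at x)"
    and Y: "\<And>x y. ((\<lambda>s. Y (x, s)) has_real_derivative Yy (x, y)) (at y)"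
    and c: "continuous_on UNIV Xx" "continuous_on UNIV Yy"
    and per: "\<And>y. X (x0 + L, y) = X (x0, y)" and "0 \<le> L" "a \<le> b"
    and cY: "continuous_on UNIV Y"
  shows "integral (cbox (x0, a) (x0 + L, b)) (\<lambda>p. Xx p + Yy p)
    = integral {x0..x0 + L} (\<lambda>x. Y (x, b)) - integral {x0..x0 + L} (\<lambda>x. Y (x, a))"
proof -
  have 1: "integral {x0..x0 + L} (\<lambda>x. Xx (x, y)) = 0" for y
    using fundamental_theorem_of_calculus[of x0 "x0 + L" "\<lambda>s. X (s, y)" "\<lambda>s. Xx (s, y)"] \<open>0 \<le> L\<close> X per
    by (auto simp: has_real_derivative_iff_has_vector_derivative has_vector_derivative_at_within
        dest!: integral_unique)
  have 2: "integral {a..b} (\<lambda>y. Yy (x, y)) = Y (x, b) - Y (x, a)" for x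
    using fundamental_theorem_of_calculus[of a b "\<lambda>s. Y (x, s)" "\<lambda>s. Yy (x, s)"] \<open>a \<le> b\<close> Y
    by (auto simp: has_real_derivative_iff_has_vector_derivative has_vector_derivative_at_within
        dest!: integral_unique)
  have "integral (cbox (x0, a) (x0 + L, b)) (\<lambda>p. Xx p + Yy p)
    = integral (cbox (x0, a) (x0 + L, b)) Xx + integral (cbox (x0, a) (x0 + L, b)) Yy"
    by (intro integral_add integrable_box c)
  also have "integral (cbox (x0, a) (x0 + L, b)) Xx = 0"
    by (simp add: integral_box_iterated(2)[OF c(1)] 1)
  also have "integral (cbox (x0, a) (x0 + L, b)) Yy = integral {x0..x0 + L} (\<lambda>x. Y (x, b) - Y (x, a))"
    by (simp add: integral_box_iterated(1)[OF c(2)] 2)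
  also have "\<dots> = integral {x0..x0 + L} (\<lambda>x. Y (x, b)) - integral {x0..x0 + L} (\<lambda>x. Y (x, a))"
    by (intro integral_diff integrable_continuous_interval continuous_on_line cY)
  finally show ?thesis by simp
qed

lemma integral_box_eq_0_imp:
  fixes f :: "real \<times> real \<Rightarrow> real"
  assumes c: "continuous_on UNIV f" and nn: "\<And>p. 0 \<le> f p"
    and le: "integral (cbox (x0, a) (x1, b)) f \<le> 0" and "x0 < x1" "a < b"
    and p: "p \<in> cbox (x0, a) (x1, b)"
  shows "f p = 0"
proof -
  have "integral (cbox (x0, a) (x1, b)) f = 0"
    using le nn by (intro antisym integral_nonneg integrable_box c) auto
  then have "(f has_integral 0) (cbox (x0, a) (x1, b))"
    using integrable_box[OF c] integrable_integral by metis
  moreover have "continuous_on (cbox (x0, a) (x1, b)) f" using c continuous_on_subset by blast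
  ultimately show ?thesis
    using has_integral_0_cbox_imp_0[of "(x0, a)" "(x1, b)" f p] nn p \<open>x0 < x1\<close> \<open>a < b\<close>
    by (auto simp: box_ne_empty Basis_prod_def inner_Pair_0)
qed

subsection \<open>Unique continuation\<close>

text \<open>Hardy's inequality: the integral of (w / (y - b))^2 is at most 4 times that of w'^2.
  Stating it for a continuous \<open>f\<close> dominated by K |w| / (y - b) avoids integrating the
  singular quotient.\<close>

lemma hardy_unit_interval:
  fixes w w' f :: "real \<Rightarrow> real"
  assumes w: "\<And>y. (w has_real_derivative w' y) (at y)" and w0: "w b = 0"
    and c: "continuous_on UNIV w'" "continuous_on UNIV f"
    and le: "\<And>y. b < y \<Longrightarrow> y < b + 1 \<Longrightarrow> (y - b) * \<bar>f y\<bar> \<le> K * \<bar>w y\<bar>"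
  shows "integral {b..b + 1} (\<lambda>y. (f y)\<^sup>2) \<le> 4 * K\<^sup>2 * integral {b..b + 1} (\<lambda>y. (w' y)\<^sup>2)"
proof -
  \<comment> \<open>At y = b division by zero yields 0, which is also the limit, since w / (y - b)
    tends to w' b and w to 0. So \<open>H\<close> is continuous up to b and its increment is
    \<open>H (b + 1)\<close>, a nonnegative number dropped at the end.\<close>
  define H where "H y = (w y)\<^sup>2 / (y - b)" for y
  define H' where "H' y = (2 * w y * w' y * (y - b) - (w y)\<^sup>2) / (y - b)\<^sup>2" for y
  have dH: "(H has_real_derivative H' y) (at y)" if "y \<noteq> b" for y
    unfolding H_def H'_def using that
    by (auto intro!: derivative_eq_intros w simp: power2_eq_square)
  have Hb: "(H \<longlongrightarrow> H b) (at b)"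
  proof -
    have "((\<lambda>y. (w y - w b) / (y - b)) \<longlongrightarrow> w' b) (at b)"
      using w[of b] by (simp add: has_field_derivative_iff)
    moreover have "(w \<longlongrightarrow> w b) (at b)"
      using w[of b] DERIV_isCont isCont_def by blast
    ultimately have "((\<lambda>y. (w y - w b) / (y - b) * w y) \<longlongrightarrow> w' b * w b) (at b)"
      by (rule tendsto_mult)
    then show ?thesis by (simp add: w0 H_def [abs_def] power2_eq_square)
  qed
  have cH: "continuous_on {b..b + 1} H"
  proof (intro continuous_at_imp_continuous_on ballI)
    fix y show "isCont H y"
      using dH[of y] Hb DERIV_isCont isCont_def by (cases "y = b") blast+
  qed
  have int: "(H' has_integral H (b + 1)) {b..b + 1}"
    using fundamental_theorem_of_calculus_interior[of b "b + 1" H H'] cH dH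
    by (auto simp: has_real_derivative_iff_has_vector_derivative H_def)
  have w'2: "((\<lambda>y. (w' y)\<^sup>2) has_integral integral {b..b + 1} (\<lambda>y. (w' y)\<^sup>2)) {b..b + 1}"
    by (intro integrable_integral integrable_continuous_interval continuous_intros
        continuous_on_subset[OF c(1)]) auto
  have f2: "((\<lambda>y. (f y)\<^sup>2) has_integral integral {b..b + 1} (\<lambda>y. (f y)\<^sup>2)) {b..b + 1}"
    by (intro integrable_integral integrable_continuous_interval continuous_intros
        continuous_on_subset[OF c(2)]) auto
  have rhs: "((\<lambda>y. K\<^sup>2 * (4 * (w' y)\<^sup>2 - 2 * H' y)) has_integral
      K\<^sup>2 * (4 * integral {b..b + 1} (\<lambda>y. (w' y)\<^sup>2) - 2 * H (b + 1))) {b..b + 1}"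
    by (intro has_integral_mult_right has_integral_diff w'2 int)
  have "integral {b..b + 1} (\<lambda>y. (f y)\<^sup>2)
      \<le> K\<^sup>2 * (4 * integral {b..b + 1} (\<lambda>y. (w' y)\<^sup>2) - 2 * H (b + 1))"
  proof (rule has_integral_le)
    show "((\<lambda>y. (f y)\<^sup>2) has_integral integral {b..b + 1} (\<lambda>y. (f y)\<^sup>2)) {b<..<b + 1}"
      using f2 by (simp add: has_integral_Icc_iff_Ioo)
    show "((\<lambda>y. K\<^sup>2 * (4 * (w' y)\<^sup>2 - 2 * H' y)) has_integral
      K\<^sup>2 * (4 * integral {b..b + 1} (\<lambda>y. (w' y)\<^sup>2) - 2 * H (b + 1))) {b<..<b + 1}"
      using rhs by (simp add: has_integral_Icc_iff_Ioo)
    fix y assume y: "y \<in> {b<..<b + 1}"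
    define r where "r = y - b"
    have r: "r > 0" using y by (simp add: r_def)
    have "(r * \<bar>f y\<bar>)\<^sup>2 \<le> (K * \<bar>w y\<bar>)\<^sup>2"
      using le[of y] y r by (intro power_mono) (auto simp: r_def)
    then have "(f y)\<^sup>2 \<le> K\<^sup>2 * ((w y)\<^sup>2 / r\<^sup>2)"
      using r by (simp add: power_mult_distrib field_simps)
    also have "(w y)\<^sup>2 / r\<^sup>2 \<le> 4 * (w' y)\<^sup>2 - 2 * H' y"
    proof -
      have eq: "H' y = 2 * (w y / r) * w' y - (w y / r)\<^sup>2"
        using r unfolding H'_def r_def[symmetric]
        by (simp add: field_simps power2_eq_square)
      \<comment> \<open>With z = w / (y - b) and x = w', the two sides differ by the square (z - 2
        x)^2.\<close>
      have "z\<^sup>2 \<le> 4 * x\<^sup>2 - 2 * (2 * z * x - z\<^sup>2)" for x z :: real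
        using zero_le_power2[of "z - 2 * x"] by (simp add: power2_eq_square algebra_simps)
      then show ?thesis unfolding eq power_divide[symmetric] .
    qed
    finally show "(f y)\<^sup>2 \<le> K\<^sup>2 * (4 * (w' y)\<^sup>2 - 2 * H' y)"
      by (simp add: mult_left_mono)
  qed
  also have "\<dots> \<le> 4 * K\<^sup>2 * integral {b..b + 1} (\<lambda>y. (w' y)\<^sup>2)"
    using mult_nonneg_nonneg[of "K\<^sup>2" "H (b + 1)"] by (simp add: H_def algebra_simps)
  finally show ?thesis .
qed

text \<open>Carleman estimate for \<open>w = e\<^sup>\<tau>\<^sup>\<phi> v\<close> with \<open>\<phi>(y) = (y - b - 2)\<^sup>2 / 2\<close>: with \<open>q = \<phi>'\<close>, the square of
  the conjugated Laplacian \<open>S + T\<close>, where \<open>S = \<Delta>w + \<tau>\<^sup>2q\<^sup>2w\<close> and \<open>T = - 2\<tau>q w\<^sub>y - \<tau>w\<close>, is at least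
  \<open>4 S T\<close>, and \<open>S T\<close> is a divergence plus a positive definite form in \<open>w\<close> and \<open>w\<^sub>y\<close>.\<close>

lemma carleman_pointwise:
  fixes w wx wy wxx wxy wyy q \<tau> :: real
  shows "4 * ((- (2 * \<tau> * q * (wxx * wy + wx * wxy)) - \<tau> * (wx * wx + w * wxx))
      + (\<tau> * wx\<^sup>2 + 2 * \<tau> * q * wx * wxy - \<tau> * wy\<^sup>2 - 2 * \<tau> * q * wy * wyy
         - \<tau> * (wy * wy + w * wyy) - 3 * \<tau>^3 * q\<^sup>2 * w\<^sup>2 - 2 * \<tau>^3 * q^3 * w * wy))
      + 8 * \<tau> * wy\<^sup>2 + 8 * \<tau>^3 * q\<^sup>2 * w\<^sup>2
    \<le> (wxx + wyy - 2 * \<tau> * q * wy + (\<tau>\<^sup>2 * q\<^sup>2 - \<tau>) * w)\<^sup>2"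
proof -
  \<comment> \<open>\<open>S\<close> and \<open>T\<close> are the symmetric and antisymmetric parts
    of the conjugated Laplacian; as q has derivative 1, the term - \<tau> w belongs to
    \<open>T\<close>.\<close>
  define S where "S = wxx + wyy + \<tau>\<^sup>2 * q\<^sup>2 * w"
  define T where "T = - 2 * \<tau> * q * wy - \<tau> * w"
  have "4 * S * T \<le> (S + T)\<^sup>2"
    using zero_le_power2[of "S - T"] by (simp add: power2_eq_square algebra_simps)
  then show ?thesis
    unfolding S_def T_def by (simp add: power2_eq_square power3_eq_cube algebra_simps)
qed

text \<open>The squared weight exp(\<tau> q^2), q = y - b - 2, is at least exp(9/4 \<tau>) on the
  lower half of the strip and equals exp \<tau> on its top edge, where the only boundary term is
  left. Letting \<tau> grow forces v = 0 on the lower half. \<open>K\<close> enters only through a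
  lower bound for \<tau>, so the gain 1/2 is the same for every \<open>K\<close>.\<close>

lemma unique_continuation_strip:
  fixes v vx vy vxx vxy vyy :: "real \<times> real \<Rightarrow> real"
  assumes v: "has_grad v vx vy" and vx: "has_grad vx vxx vxy" and vy: "has_grad vy vxy vyy"
    and c: "continuous_on UNIV vxx" "continuous_on UNIV vxy" "continuous_on UNIV vyy"
    and per: "x_periodic L v" and L: "L > 0"
    and zero: "\<And>x y. y \<le> b \<Longrightarrow> v (x, y) = 0"
    and bound: "\<And>s y. s \<in> {x..x + L} \<Longrightarrow> b < y \<Longrightarrow> y < b + 1 \<Longrightarrow>
      (y - b) * \<bar>vxx (s, y) + vyy (s, y)\<bar> \<le> K * \<bar>v (s, y)\<bar>"
    and y: "y \<le> b + 1 / 2"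
  shows "v (x, y) = 0"
proof (cases "y \<le> b")
  case True
  then show ?thesis by (rule zero)
next
  case False
  have cvx: "continuous_on UNIV vx" and cvy: "continuous_on UNIV vy"
    using continuous_on_of_grad vx vy c by blast+
  have cv: "continuous_on UNIV v" using continuous_on_of_grad v cvy by blast
  have vx0: "vx (x, b) = 0" for x
    using has_gradD(1)[OF v, of b x] by (simp add: zero DERIV_unique[of "\<lambda>s. 0" "vx (x, b)" x 0])
  have vy0: "vy (x, b) = 0" for x
  proof (rule eq_0_if_eq_0_left[OF cvy])
    show "vy (x, s) = 0" if "s < b" for s
    proof (rule DERIV_unique[OF has_gradD(2)[OF v, of x s]])
      have "eventually (\<lambda>t. v (x, t) = 0) (nhds s)"
        using eventually_nhds_in_open[of "{..<b}" s] that by (auto simp: zero elim!: eventually_mono)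
      then show "((\<lambda>s. v (x, s)) has_real_derivative 0) (at s)"
        by (subst DERIV_cong_ev[OF refl _ refl]) auto
    qed
  qed
  define J where "J d f = integral (cbox (x, b) (x + L, b + d)) f" for d and f :: "real \<times> real \<Rightarrow> real"
  define A where "A = integral {x..x + L} (\<lambda>s. (vx (s, b + 1))\<^sup>2)"
  \<comment> \<open>5/4 = 9/4 - 1 is the gap between the two exponents, and \<open>A\<close> does
    not depend on \<tau>. With 2 \<tau> \<ge> K^2 the coefficient 8 \<tau> of wy^2 dominates the
    Hardy factor 4 K^2.\<close>
  have main: "exp (5 / 4 * \<tau>) * J (1 / 2) (\<lambda>p. (v p)\<^sup>2) \<le> A" if \<tau>: "\<tau> \<ge> 1" "2 * \<tau> \<ge> K\<^sup>2" for \<tau>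
  proof -
    define q where "q p = snd p - b - 2" for p :: "real \<times> real"
    define e where "e p = exp (\<tau> * (q p)\<^sup>2 / 2)" for p
    define w where "w p = e p * v p" for p
    define wx where "wx p = e p * vx p" for p
    define wy where "wy p = e p * (vy p + \<tau> * q p * v p)" for p
    define wxx where "wxx p = e p * vxx p" for p
    define wxy where "wxy p = e p * (vxy p + \<tau> * q p * vx p)" for p
    define wyy where "wyy p = e p * (vyy p + 2 * \<tau> * q p * vy p + (\<tau> + \<tau>\<^sup>2 * (q p)\<^sup>2) * v p)" for p
    have ce: "continuous_on UNIV e" and cq: "continuous_on UNIV q"
      unfolding e_def q_def by (auto intro!: continuous_intros)
    have de: "((\<lambda>s. e (x, s)) has_real_derivative \<tau> * q (x, y) * e (x, y)) (at y)" for x y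
      unfolding e_def q_def by (auto intro!: derivative_eq_intros)
    have dex: "((\<lambda>s. e (s, y)) has_real_derivative 0) (at x)" for x y
      unfolding e_def q_def by simp
    have dq: "((\<lambda>s. q (x, s)) has_real_derivative 1) (at y)" for x y
      unfolding q_def by (auto intro!: derivative_eq_intros)
    have dqx: "((\<lambda>s. q (s, y)) has_real_derivative 0) (at x)" for x y
      unfolding q_def by simp
    note [derivative_intros] = de dex dq dqx has_gradD[OF v] has_gradD[OF vx] has_gradD[OF vy]
    note ci = continuous_intros ce cq cv cvx cvy c
    have w: "has_grad w wx wy"
      by (rule has_gradI; unfold w_def wx_def wy_def)
        (auto intro!: derivative_eq_intros simp: algebra_simps)
    have wx: "has_grad wx wxx wxy"
      by (rule has_gradI; unfold wx_def wxx_def wxy_def)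
        (auto intro!: derivative_eq_intros simp: algebra_simps)
    have wy: "has_grad wy wxy wyy"
      by (rule has_gradI; unfold wy_def wxy_def wyy_def)
        (auto intro!: derivative_eq_intros simp: algebra_simps power2_eq_square)
    have cw: "continuous_on UNIV w" "continuous_on UNIV wx" "continuous_on UNIV wy"
      "continuous_on UNIV wxx" "continuous_on UNIV wxy" "continuous_on UNIV wyy"
      unfolding w_def wx_def wy_def wxx_def wxy_def wyy_def by (intro ci)+
    note ciw = continuous_intros ce cq cw
    note [derivative_intros] = has_gradD[OF w] has_gradD[OF wx] has_gradD[OF wy]
    \<comment> \<open>The flux that appears when the product of the symmetric and antisymmetric
      parts is integrated by parts; what remains is 2 \<tau> wy^2 + 2 \<tau>^3 q^2 w^2. The terms in
      wx^2 cancel, which is harmless because Hardy's inequality is applied in y only.\<close>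
    define X where "X p = - (2 * \<tau> * q p * wx p * wy p) - \<tau> * w p * wx p" for p
    define Y where "Y p = \<tau> * q p * (wx p)\<^sup>2 - \<tau> * q p * (wy p)\<^sup>2 - \<tau> * w p * wy p
      - \<tau>^3 * (q p)^3 * (w p)\<^sup>2" for p
    define Xx where "Xx p = - (2 * \<tau> * q p * (wxx p * wy p + wx p * wxy p))
      - \<tau> * (wx p * wx p + w p * wxx p)" for p
    define Yy where "Yy p = \<tau> * (wx p)\<^sup>2 + 2 * \<tau> * q p * wx p * wxy p - \<tau> * (wy p)\<^sup>2
      - 2 * \<tau> * q p * wy p * wyy p - \<tau> * (wy p * wy p + w p * wyy p)
      - 3 * \<tau>^3 * (q p)\<^sup>2 * (w p)\<^sup>2 - 2 * \<tau>^3 * (q p)^3 * w p * wy p" for p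
    have perv: "v (x + L, y) = v (x, y)" "vx (x + L, y) = vx (x, y)" "vy (x + L, y) = vy (x, y)" for x y
      using per x_periodic_grad[OF v per] periodicD by metis+
    have qL: "q (x + L, y) = q (x, y)" "e (x + L, y) = e (x, y)" for x y by (simp_all add: q_def e_def)
    have div: "J 1 (\<lambda>p. Xx p + Yy p)
      = integral {x..x + L} (\<lambda>s. Y (s, b + 1)) - integral {x..x + L} (\<lambda>s. Y (s, b))"
      unfolding J_def
    proof (rule periodic_box_divergence)
      show "((\<lambda>s. X (s, y)) has_real_derivative Xx (x, y)) (at x)" for x y
        unfolding X_def Xx_def by (auto intro!: derivative_eq_intros simp: algebra_simps)
      show "((\<lambda>s. Y (x, s)) has_real_derivative Yy (x, y)) (at y)" for x y
        unfolding Y_def Yy_def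
        by (auto intro!: derivative_eq_intros simp: algebra_simps power2_eq_square power3_eq_cube)
      show "continuous_on UNIV Xx" "continuous_on UNIV Yy" "continuous_on UNIV Y"
        unfolding Xx_def Yy_def Y_def by (intro ciw)+
      show "X (x + L, y) = X (x, y)" for y
        by (simp add: X_def w_def wx_def wy_def perv qL)
    qed (use L in auto)
    have Yb: "Y (s, b) = 0" for s
      by (simp add: Y_def w_def wx_def wy_def zero vx0 vy0)
    \<comment> \<open>Here q = -1, so the terms of \<open>Y\<close> in \<open>w\<close> and
      \<open>wy\<close> form a nonnegative quadratic form (complete the square, \<tau> \<ge> 1) and
      only the \<open>wx\<close> term is lost. This is why the weight is centred above the
      strip.\<close>
    have Ytop: "- (\<tau> * exp \<tau>) * (vx (s, b + 1))\<^sup>2 \<le> Y (s, b + 1)" for s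
    proof -
      have q1: "q (s, b + 1) = - 1" by (simp add: q_def)
      have "(exp (\<tau> / 2))\<^sup>2 = exp \<tau>" by (simp add: power2_eq_square flip: exp_add)
      then have "(wx (s, b + 1))\<^sup>2 = exp \<tau> * (vx (s, b + 1))\<^sup>2"
        by (simp add: wx_def e_def q1 power_mult_distrib)
      moreover have "0 \<le> \<tau> * ((wy (s, b + 1) - w (s, b + 1) / 2)\<^sup>2 + (\<tau>\<^sup>2 - 1 / 4) * (w (s, b + 1))\<^sup>2)"
      proof -
        have "0 \<le> \<tau>\<^sup>2 - 1 / 4" using one_le_power[OF \<tau>(1), of 2] by linarith
        then show ?thesis using \<tau>(1) by (intro mult_nonneg_nonneg add_nonneg_nonneg) auto
      qed
      ultimately show ?thesis
        unfolding Y_def q1 by (simp add: algebra_simps power2_eq_square power3_eq_cube)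
    qed
    have "- (\<tau> * exp \<tau>) * A = integral {x..x + L} (\<lambda>s. - (\<tau> * exp \<tau>) * (vx (s, b + 1))\<^sup>2)"
      by (simp add: A_def)
    also have "\<dots> \<le> integral {x..x + L} (\<lambda>s. Y (s, b + 1))"
    proof (intro integral_le integrable_continuous_interval Ytop)
      show "continuous_on {x..x + L} (\<lambda>s. - (\<tau> * exp \<tau>) * (vx (s, b + 1))\<^sup>2)"
        by (intro continuous_intros continuous_on_line[OF cvx])
      show "continuous_on {x..x + L} (\<lambda>s. Y (s, b + 1))"
        unfolding Y_def by (intro continuous_intros continuous_on_line cq cw)
    qed
    also have "\<dots> = J 1 (\<lambda>p. Xx p + Yy p)" by (simp add: div Yb)
    finally have flux: "- (\<tau> * exp \<tau>) * A \<le> J 1 (\<lambda>p. Xx p + Yy p)" .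
    define F where "F p = e p * (vxx p + vyy p)" for p
    have Feq: "F p = wxx p + wyy p - 2 * \<tau> * q p * wy p + (\<tau>\<^sup>2 * (q p)\<^sup>2 - \<tau>) * w p" for p
      unfolding F_def w_def wy_def wxx_def wyy_def by (simp add: algebra_simps power2_eq_square)
    have cF: "continuous_on UNIV F" unfolding F_def by (intro ci)
    have J_mono: "J d f \<le> J d g"
      if "continuous_on UNIV f" "continuous_on UNIV g" "\<And>p. p \<in> cbox (x, b) (x + L, b + d) \<Longrightarrow> f p \<le> g p" for d f g
      unfolding J_def using that by (intro integral_le integrable_box)
    have J_add: "J d (\<lambda>p. f p + g p) = J d f + J d g" if "continuous_on UNIV f" "continuous_on UNIV g" for d f g
      unfolding J_def by (intro integral_add integrable_box that)
    have J_mult: "J d (\<lambda>p. k * f p) = k * J d f" for d k f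
      by (simp add: J_def)
    have cXY: "continuous_on UNIV Xx" "continuous_on UNIV Yy"
      unfolding Xx_def Yy_def by (intro ciw)+
    have "4 * J 1 (\<lambda>p. Xx p + Yy p) + 8 * \<tau> * J 1 (\<lambda>p. (wy p)\<^sup>2) + 8 * \<tau>^3 * J 1 (\<lambda>p. (q p)\<^sup>2 * (w p)\<^sup>2)
      = J 1 (\<lambda>p. 4 * (Xx p + Yy p) + 8 * \<tau> * (wy p)\<^sup>2 + 8 * \<tau>^3 * ((q p)\<^sup>2 * (w p)\<^sup>2))"
    proof -
      have "J 1 (\<lambda>p. 4 * (Xx p + Yy p) + 8 * \<tau> * (wy p)\<^sup>2 + 8 * \<tau>^3 * ((q p)\<^sup>2 * (w p)\<^sup>2))
        = J 1 (\<lambda>p. 4 * (Xx p + Yy p) + 8 * \<tau> * (wy p)\<^sup>2) + J 1 (\<lambda>p. 8 * \<tau>^3 * ((q p)\<^sup>2 * (w p)\<^sup>2))"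
        by (intro J_add ciw cXY)
      also have "J 1 (\<lambda>p. 4 * (Xx p + Yy p) + 8 * \<tau> * (wy p)\<^sup>2)
        = J 1 (\<lambda>p. 4 * (Xx p + Yy p)) + J 1 (\<lambda>p. 8 * \<tau> * (wy p)\<^sup>2)"
        by (intro J_add ciw cXY)
      finally show ?thesis unfolding J_mult by (rule sym)
    qed
    also have "\<dots> \<le> J 1 (\<lambda>p. (F p)\<^sup>2)"
    proof (rule J_mono)
      show "4 * (Xx p + Yy p) + 8 * \<tau> * (wy p)\<^sup>2 + 8 * \<tau>^3 * ((q p)\<^sup>2 * (w p)\<^sup>2) \<le> (F p)\<^sup>2" for p
        unfolding Feq Xx_def Yy_def using carleman_pointwise[where q="q p" and w="w p" and wx="wx p"
            and wy="wy p" and wxx="wxx p" and wxy="wxy p" and wyy="wyy p" and \<tau>=\<tau>]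
        by (simp only: mult.assoc)
    qed (intro ciw cXY cF)+
    also have "\<dots> \<le> 4 * K\<^sup>2 * J 1 (\<lambda>p. (wy p)\<^sup>2)"
    proof -
      have cF2: "continuous_on UNIV (\<lambda>p. (F p)\<^sup>2)" and cwy2: "continuous_on UNIV (\<lambda>p. (wy p)\<^sup>2)"
        by (intro ciw cF)+
      have "J 1 (\<lambda>p. (F p)\<^sup>2) = integral {x..x + L} (\<lambda>s. integral {b..b + 1} (\<lambda>t. (F (s, t))\<^sup>2))"
        unfolding J_def by (rule integral_box_iterated(1)[OF cF2])
      also have "\<dots> \<le> integral {x..x + L} (\<lambda>s. 4 * K\<^sup>2 * integral {b..b + 1} (\<lambda>t. (wy (s, t))\<^sup>2))"
      proof (rule integral_le)
        have ip: "(\<lambda>s. integral {b..b + 1} (\<lambda>t. f (s, t))) integrable_on {x..x + L}"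
          if "continuous_on UNIV f" for f :: "real \<times> real \<Rightarrow> real"
          using integral_continuous_on_param[of "{x..x + L}" b "b + 1" "\<lambda>s t. f (s, t)"]
            continuous_on_subset[OF that] by (intro integrable_continuous_interval) auto
        show "(\<lambda>s. integral {b..b + 1} (\<lambda>t. (F (s, t))\<^sup>2)) integrable_on {x..x + L}"
          by (rule ip[OF cF2])
        show "(\<lambda>s. 4 * K\<^sup>2 * integral {b..b + 1} (\<lambda>t. (wy (s, t))\<^sup>2)) integrable_on {x..x + L}"
          by (intro integrable_on_mult_right ip cwy2)
        show "integral {b..b + 1} (\<lambda>t. (F (s, t))\<^sup>2)
          \<le> 4 * K\<^sup>2 * integral {b..b + 1} (\<lambda>t. (wy (s, t))\<^sup>2)" if s: "s \<in> {x..x + L}" for s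
        proof (rule hardy_unit_interval[where w="\<lambda>t. w (s, t)"])
          show "((\<lambda>t. w (s, t)) has_real_derivative wy (s, t)) (at t)" for t
            by (rule has_gradD[OF w])
          show "w (s, b) = 0" by (simp add: w_def zero)
          fix t assume "b < t" "t < b + 1"
          then have "e (s, t) * ((t - b) * \<bar>vxx (s, t) + vyy (s, t)\<bar>) \<le> e (s, t) * (K * \<bar>v (s, t)\<bar>)"
            using s by (intro mult_left_mono bound) (auto simp: e_def)
          then show "(t - b) * \<bar>F (s, t)\<bar> \<le> K * \<bar>w (s, t)\<bar>"
            by (simp add: F_def w_def abs_mult e_def mult_ac)
        qed (intro continuous_on_line cw cF)+
      qed
      also have "\<dots> = 4 * K\<^sup>2 * J 1 (\<lambda>p. (wy p)\<^sup>2)"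
        unfolding J_def by (simp add: integral_box_iterated(1)[OF cwy2])
      finally show ?thesis .
    qed
    also have "\<dots> \<le> 8 * \<tau> * J 1 (\<lambda>p. (wy p)\<^sup>2)"
      using \<tau>(2) by (intro mult_right_mono) (auto simp: J_def intro!: integral_nonneg integrable_box ciw)
    finally have "8 * \<tau>^3 * J 1 (\<lambda>p. (q p)\<^sup>2 * (w p)\<^sup>2) \<le> 4 * (\<tau> * exp \<tau>) * A"
      using flux by (simp add: algebra_simps)
    moreover have "4 * \<tau> * J 1 (\<lambda>p. (q p)\<^sup>2 * (w p)\<^sup>2) \<le> 8 * \<tau>^3 * J 1 (\<lambda>p. (q p)\<^sup>2 * (w p)\<^sup>2)"
    proof (rule mult_right_mono)
      show "4 * \<tau> \<le> 8 * \<tau> ^ 3" using \<tau>(1) power_increasing[of 1 3 \<tau>] by simp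
    qed (auto simp: J_def intro!: integral_nonneg integrable_box ciw)
    ultimately have "4 * \<tau> * J 1 (\<lambda>p. (q p)\<^sup>2 * (w p)\<^sup>2) \<le> 4 * (\<tau> * exp \<tau>) * A" by (rule order_trans[rotated])
    then have "\<tau> * J 1 (\<lambda>p. (q p)\<^sup>2 * (w p)\<^sup>2) \<le> \<tau> * (exp \<tau> * A)" by (simp add: mult.assoc)
    then have up: "J 1 (\<lambda>p. (q p)\<^sup>2 * (w p)\<^sup>2) \<le> exp \<tau> * A" using \<tau>(1) by simp
    have "exp (9 / 4 * \<tau>) * J (1 / 2) (\<lambda>p. (v p)\<^sup>2) = J (1 / 2) (\<lambda>p. exp (9 / 4 * \<tau>) * (v p)\<^sup>2)"
      by (simp add: J_mult)
    also have "\<dots> \<le> J (1 / 2) (\<lambda>p. (q p)\<^sup>2 * (w p)\<^sup>2)"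
    proof (rule J_mono)
      fix p assume p: "p \<in> cbox (x, b) (x + L, b + 1 / 2)"
      then have "q p \<le> - (3 / 2)" by (cases p) (auto simp: q_def)
      then have "(3 / 2)\<^sup>2 \<le> (- q p)\<^sup>2" by (intro power_mono) auto
      then have q2: "9 / 4 \<le> (q p)\<^sup>2" by (simp add: power2_eq_square)
      have "exp (9 / 4 * \<tau>) \<le> exp (\<tau> * (q p)\<^sup>2)"
        using q2 \<tau>(1) mult_left_mono[OF q2, of \<tau>] by simp
      also have "\<dots> = 1 * (e p)\<^sup>2" by (simp add: e_def power2_eq_square flip: exp_add)
      also have "\<dots> \<le> (q p)\<^sup>2 * (e p)\<^sup>2" using q2 by (intro mult_right_mono) auto
      finally have "exp (9 / 4 * \<tau>) * (v p)\<^sup>2 \<le> (q p)\<^sup>2 * (e p)\<^sup>2 * (v p)\<^sup>2"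
        by (intro mult_right_mono) auto
      then show "exp (9 / 4 * \<tau>) * (v p)\<^sup>2 \<le> (q p)\<^sup>2 * (w p)\<^sup>2"
        by (simp add: w_def power_mult_distrib mult_ac)
    qed (intro ci cw)+
    also have "\<dots> \<le> J 1 (\<lambda>p. (q p)\<^sup>2 * (w p)\<^sup>2)"
      unfolding J_def by (intro integral_subset_le integrable_box ciw) (auto simp: cbox_Pair_eq)
    also note up
    also have "exp (9 / 4 * \<tau>) = exp \<tau> * exp (5 / 4 * \<tau>)" by (simp flip: exp_add)
    finally show ?thesis by simp
  qed
  have "J (1 / 2) (\<lambda>p. (v p)\<^sup>2) \<le> 0"
  proof (rule ccontr)
    assume "\<not> ?thesis"
    then have pos: "J (1 / 2) (\<lambda>p. (v p)\<^sup>2) > 0" by simp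
    \<comment> \<open>Any \<tau> \<ge> |A| / J gives |A| \<le> \<tau> J < exp(5/4 \<tau>) J, against
      \<open>main\<close>.\<close>
    define \<tau> where "\<tau> = Max {1, K\<^sup>2, \<bar>A\<bar> / J (1 / 2) (\<lambda>p. (v p)\<^sup>2)}"
    have \<tau>: "\<tau> \<ge> 1" "\<tau> \<ge> K\<^sup>2" "\<bar>A\<bar> / J (1 / 2) (\<lambda>p. (v p)\<^sup>2) \<le> \<tau>" by (auto simp: \<tau>_def)
    have "\<bar>A\<bar> \<le> \<tau> * J (1 / 2) (\<lambda>p. (v p)\<^sup>2)" using \<tau>(3) pos by (simp add: field_simps)
    also have "\<tau> < exp (5 / 4 * \<tau>)" using exp_ge_add_one_self[of "5 / 4 * \<tau>"] \<tau>(1) by linarith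
    then have "\<tau> * J (1 / 2) (\<lambda>p. (v p)\<^sup>2) < exp (5 / 4 * \<tau>) * J (1 / 2) (\<lambda>p. (v p)\<^sup>2)"
      using pos by (rule mult_strict_right_mono)
    also have "\<dots> \<le> A" using \<tau> by (intro main) auto
    finally show False by simp
  qed
  then have "(v (x, y))\<^sup>2 = 0"
    unfolding J_def using False y L
    by (intro integral_box_eq_0_imp[of "\<lambda>p. (v p)\<^sup>2" x b "x + L" "b + 1 / 2"])
      (auto intro!: continuous_intros cv)
  then show ?thesis by simp
qed

subsection \<open>The region below the critical level\<close>

text \<open>For s < 0 the function tends to - 1 / a = 1 / s as \<epsilon> tends to 0; for s \<ge> 0
  it vanishes. The square in the numerator makes it C^1 across s = 0, and the cube restores the
  order of 1 / s.\<close>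

lemma cutoff_derivative:
  fixes \<epsilon> :: real
  assumes "\<epsilon> > 0"
  defines "a \<equiv> \<lambda>s::real. max (- s) 0"
  shows "((\<lambda>s. - (a s)\<^sup>2 / (a s + \<epsilon>)^3) has_real_derivative
      (2 * a s * \<epsilon> - (a s)\<^sup>2) / (a s + \<epsilon>)^4) (at s)"
proof -
  consider "s < 0" | "s = 0" | "s > 0" by linarith
  then show ?thesis
  proof cases
    case 1
    have ev: "eventually (\<lambda>t. - (a t)\<^sup>2 / (a t + \<epsilon>)^3 = - t\<^sup>2 / (\<epsilon> - t)^3) (nhds s)"
      using eventually_nhds_in_open[of "{..<0}" s] 1
      by (auto simp: a_def max_def elim!: eventually_mono)
    have d: "((\<lambda>t. - t\<^sup>2 / (\<epsilon> - t)^3) has_real_derivative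
        (2 * (- s) * \<epsilon> - (- s)\<^sup>2) / (- s + \<epsilon>)^4) (at s)"
    proof -
      have ne: "\<epsilon> - s \<noteq> 0" using assms 1 by simp
      have "((\<lambda>t. - t\<^sup>2 / (\<epsilon> - t)^3) has_real_derivative
        (- (2 * s) * (\<epsilon> - s)^3 + s\<^sup>2 * (- 3 * (\<epsilon> - s)\<^sup>2)) / ((\<epsilon> - s)^3 * (\<epsilon> - s)^3)) (at s)"
        using ne by (auto intro!: derivative_eq_intros
            simp: power2_eq_square diff_divide_distrib add_divide_distrib)
      also have "- (2 * s) * (\<epsilon> - s)^3 + s\<^sup>2 * (- 3 * (\<epsilon> - s)\<^sup>2)
        = (2 * (- s) * \<epsilon> - (- s)\<^sup>2) * (\<epsilon> - s)\<^sup>2"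
        by (simp add: power2_eq_square power3_eq_cube algebra_simps)
      also have "\<dots> / ((\<epsilon> - s)^3 * (\<epsilon> - s)^3) = (2 * (- s) * \<epsilon> - (- s)\<^sup>2) / (- s + \<epsilon>)^4"
        using ne by (simp add: divide_simps flip: power_add)
      finally show ?thesis .
    qed
    have as: "a s = - s" using 1 by (simp add: a_def)
    show ?thesis unfolding as by (rule DERIV_cong_ev[OF refl ev refl, THEN iffD2, OF d])
  next
    case 2
    have "((\<lambda>h. (- (a h)\<^sup>2 / (a h + \<epsilon>)^3) / h) \<longlongrightarrow> 0) (at 0)"
    proof (rule Lim_null_comparison)
      show "\<forall>\<^sub>F h in at 0. norm ((- (a h)\<^sup>2 / (a h + \<epsilon>)^3) / h) \<le> \<bar>h\<bar> / \<epsilon>^3"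
      proof (intro always_eventually allI)
        fix h :: real
        have "(a h)\<^sup>2 / (a h + \<epsilon>)^3 \<le> h\<^sup>2 / \<epsilon>^3"
        proof (rule frac_le)
          show "(a h)\<^sup>2 \<le> h\<^sup>2" by (simp add: a_def max_def)
          show "\<epsilon>^3 \<le> (a h + \<epsilon>)^3" using assms(1) by (intro power_mono) (auto simp: a_def)
        qed (use assms(1) in auto)
        then have "(a h)\<^sup>2 / (a h + \<epsilon>)^3 / \<bar>h\<bar> \<le> h\<^sup>2 / \<epsilon>^3 / \<bar>h\<bar>"
          by (rule divide_right_mono) simp
        also have eq: "\<dots> = \<bar>h\<bar> / \<epsilon>^3" by (cases "h = 0") (auto simp: power2_eq_square abs_if)
        finally have le: "(a h)\<^sup>2 / (a h + \<epsilon>)^3 / \<bar>h\<bar> \<le> \<bar>h\<bar> / \<epsilon>^3" .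
        show "norm ((- (a h)\<^sup>2 / (a h + \<epsilon>)^3) / h) \<le> \<bar>h\<bar> / \<epsilon>^3"
        proof -
          have "a h + \<epsilon> > 0" using assms(1) by (simp add: a_def add_nonneg_pos)
          then show ?thesis using le by (simp add: abs_mult power_abs)
        qed
      qed
      show "((\<lambda>h. \<bar>h\<bar> / \<epsilon>^3) \<longlongrightarrow> 0) (at 0)"
        using assms(1) by (auto intro!: tendsto_eq_intros)
    qed
    then show ?thesis using 2 by (simp add: has_field_derivative_iff a_def)
  next
    case 3
    have ev: "eventually (\<lambda>t. - (a t)\<^sup>2 / (a t + \<epsilon>)^3 = 0) (nhds s)"
      using eventually_nhds_in_open[of "{0<..}" s] 3
      by (auto simp: a_def max_def elim!: eventually_mono)
    have "a s = 0" using 3 by (simp add: a_def)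
    then show ?thesis using DERIV_cong_ev[OF refl ev refl, THEN iffD2, OF DERIV_const] by simp
  qed
qed

text \<open>The equation says \<open>div (s\<nabla>v - v\<nabla>u) = - \<beta>v\<close> with \<open>s = u - c\<close>. Testing with \<open>v/s\<close> on the
  region \<open>s < 0\<close> gives \<open>\<integral> \<bar>\<nabla>v - (v/s)\<nabla>u\<bar>\<^sup>2 = \<beta> \<integral> v\<^sup>2/s + boundary terms\<close>, where the right-hand side is
  at most what comes from \<open>v v\<^sub>y\<close> at \<open>y \<rightarrow> - \<infinity>\<close>. To stay away from the curve \<open>s = 0\<close>, the factor
  \<open>1/s\<close> is replaced by \<open>- a\<^sup>2/(a + \<epsilon>)\<^sup>3\<close> with \<open>a = max (- s) 0\<close>.\<close>

lemma vanishes_below_critical_level: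
  fixes u v :: "real \<times> real \<Rightarrow> real"
  assumes u: "has_grad u ux uy" and ux: "has_grad ux uxx uxy" and uy: "has_grad uy uyx uyy"
    and cu: "continuous_on UNIV uxx" "continuous_on UNIV uxy" "continuous_on UNIV uyy"
    and v: "has_grad v vx vy" and vx: "has_grad vx vxx vxy" and vy: "has_grad vy vyx vyy"
    and cv: "continuous_on UNIV vxx" "continuous_on UNIV vxy" "continuous_on UNIV vyy"
    and per: "x_periodic L u" "x_periodic L v" and L: "L > 0"
    and eq: "\<And>p. (u p - c) * (vxx p + vyy p) + v p * (\<beta> - (uxx p + uyy p)) = 0" and \<beta>: "\<beta> \<ge> 0"
    and C0: "C\<^sub>0 > 0" and uy_ge: "\<And>p. C\<^sub>0 \<le> uy p"
    and level: "\<And>p. u p = c \<Longrightarrow> v p = 0"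
    and vx_le: "\<And>p. \<bar>vx p\<bar> \<le> K" and vy_le: "\<And>p. \<bar>vy p\<bar> \<le> K"
    and lim: "\<And>x. ((\<lambda>y. v (x, y)) \<longlongrightarrow> 0) at_bot"
    and below: "u p < c"
  shows "v p = 0"
proof -
  have cux: "continuous_on UNIV ux" and cuy: "continuous_on UNIV uy"
    and cvx: "continuous_on UNIV vx" and cvy: "continuous_on UNIV vy"
    using continuous_on_of_grad ux uy vx vy cu cv by blast+
  have cu0: "continuous_on UNIV u" and cv0: "continuous_on UNIV v"
    using continuous_on_of_grad u v cuy cvy by blast+
  have K: "K \<ge> 0" using vx_le[of p] by linarith
  note u_incr = increment_ge[OF u uy_ge]
  define s where "s p = u p - c" for p
  define K1 where "K1 = K / C\<^sub>0"
  have K1: "K1 \<ge> 0" using K C0 by (simp add: K1_def)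
  \<comment> \<open>On the vertical line through p the level u = c is met within distance |s| /
    \<open>C\<^sub>0\<close>, and v vanishes there. So v / s is bounded up to the level set.\<close>
  have v_le: "\<bar>v p\<bar> \<le> K1 * \<bar>s p\<bar>" for p
  proof -
    obtain x y where p: "p = (x, y)" by force
    define d where "d = \<bar>s p\<bar> / C\<^sub>0"
    have d: "d \<ge> 0" "C\<^sub>0 * d = \<bar>s p\<bar>" using C0 by (auto simp: d_def)
    have "\<exists>g. y - d \<le> g \<and> g \<le> y + d \<and> u (x, g) = c"
    proof (rule IVT')
      show "u (x, y - d) \<le> c" "c \<le> u (x, y + d)"
        using u_incr[of "y - d" y x] u_incr[of y "y + d" x] d by (auto simp: s_def p)
    qed (use d in \<open>auto intro: continuous_on_line cu0\<close>)
    then obtain g where "y - d \<le> g" "g \<le> y + d" and level_g: "u (x, g) = c" by blast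
    then have g: "\<bar>y - g\<bar> \<le> d" by linarith
    have "\<bar>v (x, y) - v (x, g)\<bar> \<le> K * \<bar>y - g\<bar>"
      using field_differentiable_bound[of UNIV "\<lambda>t. v (x, t)" "\<lambda>t. vy (x, t)" K y g]
        has_gradD(2)[OF v] vy_le by simp
    also have "\<dots> \<le> K * d" using g K by (intro mult_left_mono)
    finally show ?thesis using level[OF level_g] by (simp add: p d_def K1_def)
  qed
  define a where "a p = max (- s p) 0" for p
  have a: "a p \<ge> 0" "s p < 0 \<Longrightarrow> s p = - a p" "s p \<ge> 0 \<Longrightarrow> a p = 0" for p
    by (auto simp: a_def)
  have ca: "continuous_on UNIV a" and cs: "continuous_on UNIV s"
    unfolding a_def s_def by (intro continuous_intros cu0)+
  \<comment> \<open>\<open>(Gx, Gy)\<close> is s^2 times the gradient of v / s, written without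
    division.\<close>
  define Gx where "Gx p = s p * vx p - v p * ux p" for p
  define Gy where "Gy p = s p * vy p - v p * uy p" for p
  note ci = continuous_intros ca cs cu0 cux cuy cv0 cvx cvy cu cv
  have cG: "continuous_on UNIV Gx" "continuous_on UNIV Gy"
    unfolding Gx_def Gy_def by (intro ci)+
  have G_le: "\<bar>Gx p\<bar> \<le> a p * (K + K1 * \<bar>ux p\<bar>)" "\<bar>Gy p\<bar> \<le> a p * (K + K1 * \<bar>uy p\<bar>)"
    and va_le: "\<bar>v p\<bar> \<le> K1 * a p" if "s p < 0" for p
  proof -
    have sa: "\<bar>s p\<bar> = a p" using a(1,2) that by (metis abs_minus_cancel abs_of_nonneg)
    show va: "\<bar>v p\<bar> \<le> K1 * a p" using v_le[of p] sa by simp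
    have "\<bar>s p * w - v p * z\<bar> \<le> a p * (K + K1 * \<bar>z\<bar>)" if "\<bar>w\<bar> \<le> K" for w z
    proof -
      have "\<bar>s p * w - v p * z\<bar> \<le> \<bar>s p\<bar> * \<bar>w\<bar> + \<bar>v p\<bar> * \<bar>z\<bar>"
        unfolding abs_mult[symmetric] by linarith
      also have "\<dots> \<le> a p * K + K1 * a p * \<bar>z\<bar>"
        using that a(1) va sa by (intro add_mono mult_mono) auto
      finally show ?thesis by (simp add: algebra_simps)
    qed
    then show "\<bar>Gx p\<bar> \<le> a p * (K + K1 * \<bar>ux p\<bar>)" "\<bar>Gy p\<bar> \<le> a p * (K + K1 * \<bar>uy p\<bar>)"
      using vx_le vy_le by (auto simp: Gx_def Gy_def)
  qed
  \<comment> \<open>The cutoff has derivative 3 a \<epsilon> / (a + \<epsilon>)^4 - a / (a +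
    \<epsilon>)^3. The second term completes the square in \<open>(Gx, Gy)\<close>; the first leaves
    this error.\<close>
  define err where "err \<epsilon> p = 3 * a p * \<epsilon> / (a p + \<epsilon>)^4 * (v p * (ux p * Gx p + uy p * Gy p))" for \<epsilon> p
  \<comment> \<open>The energy density carries the weight a / (a + \<epsilon>)^3, bounded below by
    its value at \<epsilon> = 1. With this fixed \<open>F\<close> only \<open>err\<close> has to
    converge as \<epsilon> tends to 0.\<close>
  define F where "F p = a p / (a p + 1)^3 * (Gy p)\<^sup>2" for p
  have pos: "a p + \<epsilon> > 0" if "\<epsilon> > 0" for \<epsilon> p using a(1)[of p] that by simp
  have cerr: "continuous_on UNIV (err \<epsilon>)" if "\<epsilon> > 0" for \<epsilon>
    unfolding err_def using pos[OF that] by (intro ci cG) (auto simp: less_imp_neq[symmetric])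
  have cF: "continuous_on UNIV F"
    unfolding F_def using pos[of 1] by (intro ci cG) (auto simp: less_imp_neq[symmetric])
  have F0: "F p \<ge> 0" for p using a(1) by (auto simp: F_def)
  have Gy0: "Gy p = 0" if "s p < 0" for p
  proof -
    obtain x y where p: "p = (x, y)" by force
    obtain m where m: "\<And>t. t \<in> {x..x + L} \<Longrightarrow> m \<le> u (t, 0)"
      using continuous_attains_inf[of "{x..x + L}" "\<lambda>t. u (t, 0)"] L continuous_on_line(1)[OF cu0]
      by fastforce
    \<comment> \<open>At height \<open>N\<close> the whole period lies in u \<ge> c, so the cutoff
      kills the flux through the top edge; \<open>N\<close> above \<open>y\<close> keeps p inside
      the box.\<close>
    define N where "N = Max {0, y + 1, (c - m) / C\<^sub>0}"
    have N: "N \<ge> 0" "N > y" "N \<ge> (c - m) / C\<^sub>0" by (auto simp: N_def less_max_iff_disj)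
    have top: "s (t, N) \<ge> 0" if "t \<in> {x..x + L}" for t
      using u_incr[of 0 N t] m[OF that] N C0 by (simp add: s_def field_simps)
    define J where "J M f = integral (cbox (x, - M) (x + L, N)) f" for M and f :: "real \<times> real \<Rightarrow> real"
    have est: "J M F + J M (err \<epsilon>) \<le> K * integral {x..x + L} (\<lambda>t. \<bar>v (t, - M)\<bar>)"
      if \<epsilon>: "0 < \<epsilon>" "\<epsilon> \<le> 1" and M: "- M \<le> N" for \<epsilon> M
    proof -
      define \<rho> where "\<rho> p = - (a p)\<^sup>2 / (a p + \<epsilon>)^3" for p
      define \<rho>' where "\<rho>' p = (2 * a p * \<epsilon> - (a p)\<^sup>2) / (a p + \<epsilon>)^4" for p
      have ne: "a p + \<epsilon> \<noteq> 0" for p using pos[OF \<epsilon>(1), of p] by simp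
      have c\<rho>: "continuous_on UNIV \<rho>" "continuous_on UNIV \<rho>'"
        unfolding \<rho>_def \<rho>'_def by (intro ci; simp add: ne)+
      have sx: "((\<lambda>t. s (t, y)) has_real_derivative ux (x, y)) (at x)"
        and sy: "((\<lambda>t. s (x, t)) has_real_derivative uy (x, y)) (at y)" for x y
        unfolding s_def by (auto intro!: derivative_eq_intros has_gradD[OF u])
      have \<rho>x: "((\<lambda>t. \<rho> (t, y)) has_real_derivative \<rho>' (x, y) * ux (x, y)) (at x)"
        and \<rho>y: "((\<lambda>t. \<rho> (x, t)) has_real_derivative \<rho>' (x, y) * uy (x, y)) (at y)" for x y
        unfolding \<rho>_def \<rho>'_def a_def
        using DERIV_chain2[OF cutoff_derivative[OF \<epsilon>(1)] sx] DERIV_chain2[OF cutoff_derivative[OF \<epsilon>(1)] sy]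
        by auto
      note dd = sx sy \<rho>x \<rho>y has_gradD[OF u] has_gradD[OF ux] has_gradD[OF uy]
        has_gradD[OF v] has_gradD[OF vx] has_gradD[OF vy]
      define X where "X p = v p * \<rho> p * Gx p" for p
      define Y where "Y p = v p * \<rho> p * Gy p" for p
      define Xx where "Xx p = (\<rho> p * vx p + v p * \<rho>' p * ux p) * Gx p
        + v p * \<rho> p * (s p * vxx p - v p * uxx p)" for p
      define Yy where "Yy p = (\<rho> p * vy p + v p * \<rho>' p * uy p) * Gy p
        + v p * \<rho> p * (s p * vyy p - v p * uyy p)" for p
      have cXY: "continuous_on UNIV Xx" "continuous_on UNIV Yy" "continuous_on UNIV Y"
        unfolding Xx_def Yy_def Y_def by (intro ci cG c\<rho>)+
      have uL: "u (x + L, y) = u (x, y)" "ux (x + L, y) = ux (x, y)"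
        "v (x + L, y) = v (x, y)" "vx (x + L, y) = vx (x, y)" for x y
        using per x_periodic_grad[OF u per(1)] x_periodic_grad[OF v per(2)] periodicD by metis+
      have div: "J M (\<lambda>p. Xx p + Yy p)
        = integral {x..x + L} (\<lambda>t. Y (t, N)) - integral {x..x + L} (\<lambda>t. Y (t, - M))"
        unfolding J_def
      proof (rule periodic_box_divergence)
        show "((\<lambda>t. X (t, y)) has_real_derivative Xx (x, y)) (at x)" for x y
          unfolding X_def Gx_def by (rule derivative_eq_intros dd refl)+ (simp add: Xx_def Gx_def algebra_simps)
        show "((\<lambda>t. Y (x, t)) has_real_derivative Yy (x, y)) (at y)" for x y
          unfolding Y_def Gy_def by (rule derivative_eq_intros dd refl)+ (simp add: Yy_def Gy_def algebra_simps)
        show "X (x + L, y) = X (x, y)" for y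
          by (simp add: X_def Gx_def \<rho>_def a_def s_def uL)
      qed (use L M cXY in auto)
      have "integral {x..x + L} (\<lambda>t. Y (t, N)) = integral {x..x + L} (\<lambda>t. 0)"
        using top a(3) by (intro integral_cong) (simp add: Y_def \<rho>_def)
      then have "J M (\<lambda>p. Xx p + Yy p) = integral {x..x + L} (\<lambda>t. - Y (t, - M))"
        using div by simp
      also have "\<dots> \<le> integral {x..x + L} (\<lambda>t. K * \<bar>v (t, - M)\<bar>)"
      proof (rule integral_le)
        show "(\<lambda>t. - Y (t, - M)) integrable_on {x..x + L}" "(\<lambda>t. K * \<bar>v (t, - M)\<bar>) integrable_on {x..x + L}"
          by (intro integrable_continuous_interval continuous_intros continuous_on_line cXY cv0)+
        fix t :: real
        define p where "p = (t, - M)"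
        have "- Y p \<le> K * \<bar>v p\<bar>"
        proof (cases "s p < 0")
          case True
          \<comment> \<open>\<theta> lies between 0 and 1 for every \<epsilon>, so the part of the
            bottom flux with v vy is at most K |v|. The part with uy has no upper bound in size, but
            \<rho> \<le> 0 gives it a sign.\<close>
          define \<theta> where "\<theta> = s p * \<rho> p"
          have \<theta>: "\<theta> = (a p)^3 / (a p + \<epsilon>)^3"
            using a(2)[OF True] by (simp add: \<theta>_def \<rho>_def power2_eq_square power3_eq_cube)
          have "0 \<le> \<theta>" "\<theta> \<le> 1"
            unfolding \<theta> using a(1)[of p] \<epsilon> by (auto intro!: divide_le_eq_1_pos[THEN iffD2] power_mono)
          have "- Y p = - (\<theta> * (v p * vy p)) + \<rho> p * (uy p * (v p)\<^sup>2)"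
            by (simp add: Y_def Gy_def \<theta>_def algebra_simps power2_eq_square)
          also have "\<rho> p * (uy p * (v p)\<^sup>2) \<le> 0"
          proof (rule mult_nonpos_nonneg)
            show "\<rho> p \<le> 0" using pos[OF \<epsilon>(1), of p] by (simp add: \<rho>_def)
            show "0 \<le> uy p * (v p)\<^sup>2" using uy_ge[of p] C0 by simp
          qed
          also have "- (\<theta> * (v p * vy p)) \<le> \<bar>\<theta> * (v p * vy p)\<bar>" by simp
          also have "\<dots> = \<theta> * (\<bar>v p\<bar> * \<bar>vy p\<bar>)" using \<open>0 \<le> \<theta>\<close> by (simp add: abs_mult)
          also have "\<dots> \<le> 1 * (\<bar>v p\<bar> * K)"
            using \<open>0 \<le> \<theta>\<close> \<open>\<theta> \<le> 1\<close> vy_le by (intro mult_mono mult_left_mono) auto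
          finally show ?thesis by (simp add: mult.commute)
        next
          case False
          then show ?thesis using a(3)[of p] K by (simp add: Y_def \<rho>_def)
        qed
        then show "- Y (t, - M) \<le> K * \<bar>v (t, - M)\<bar>" by (simp add: p_def)
      qed
      finally have up: "J M (\<lambda>p. Xx p + Yy p) \<le> K * integral {x..x + L} (\<lambda>t. \<bar>v (t, - M)\<bar>)" by simp
      have "F p + err \<epsilon> p \<le> Xx p + Yy p" for p
      proof -
        define A where "A = a p"
        have A: "A \<ge> 0" "A + \<epsilon> \<noteq> 0" using a(1) ne by (simp_all add: A_def)
        define k where "k = A / (A + \<epsilon>)^3"
        have s\<Delta>: "s p * vxx p - v p * uxx p + (s p * vyy p - v p * uyy p) = - \<beta> * v p"
          using eq[of p] by (simp add: s_def algebra_simps)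
        have "Xx p + Yy p = (\<rho> p * vx p + v p * \<rho>' p * ux p) * Gx p + (\<rho> p * vy p + v p * \<rho>' p * uy p) * Gy p
            + v p * \<rho> p * (s p * vxx p - v p * uxx p + (s p * vyy p - v p * uyy p))"
          by (simp add: Xx_def Yy_def algebra_simps)
        also have "\<dots> = (\<rho> p * vx p + v p * \<rho>' p * ux p) * Gx p + (\<rho> p * vy p + v p * \<rho>' p * uy p) * Gy p
            + - \<rho> p * (\<beta> * (v p)\<^sup>2)"
          unfolding s\<Delta> by (simp add: power2_eq_square)
        finally have 1: "Xx p + Yy p \<ge> (\<rho> p * vx p + v p * \<rho>' p * ux p) * Gx p
            + (\<rho> p * vy p + v p * \<rho>' p * uy p) * Gy p"
          using \<beta> a(1)[of p] \<epsilon> by (simp add: \<rho>_def)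
        have \<rho>k: "\<rho> p = - A * k" by (simp add: \<rho>_def k_def A_def power2_eq_square)
        have \<rho>'k: "\<rho>' p = 3 * A * \<epsilon> / (A + \<epsilon>)^4 - k"
        proof -
          have "k = A * (A + \<epsilon>) / (A + \<epsilon>)^4"
            using A(2) by (simp add: k_def power_numeral_reduce divide_simps)
          then show ?thesis
            unfolding \<rho>'_def A_def[symmetric]
            by (simp add: power2_eq_square algebra_simps flip: diff_divide_distrib)
        qed
        \<comment> \<open>For s = - A one has \<rho> = k s, and the part - k of \<rho>' adds - k v
          z, together k G. For s \<ge> 0 everything is 0.\<close>
        have key: "(\<rho> p * w + v p * \<rho>' p * z) * G = k * G\<^sup>2 + 3 * A * \<epsilon> / (A + \<epsilon>)^4 * (v p * (z * G))"
          if G: "G = s p * w - v p * z" for w z G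
        proof (cases "s p < 0")
          case True
          then have "s p = - A" using a(2) by (simp add: A_def)
          then have "\<rho> p * w + v p * \<rho>' p * z = k * G + 3 * A * \<epsilon> / (A + \<epsilon>)^4 * (v p * z)"
            by (simp add: G \<rho>k \<rho>'k algebra_simps)
          then show ?thesis by (simp add: power2_eq_square algebra_simps)
        next
          case False
          then have "A = 0" using a(3) by (simp add: A_def)
          then show ?thesis by (simp add: \<rho>k \<rho>'k k_def)
        qed
        have 2: "Xx p + Yy p \<ge> k * (Gx p)\<^sup>2 + k * (Gy p)\<^sup>2 + err \<epsilon> p"
          using 1 unfolding key[OF Gx_def] key[OF Gy_def] err_def A_def[symmetric]
          by (simp add: algebra_simps)
        have "A / (A + 1)^3 \<le> k"
          unfolding k_def using A \<epsilon> by (intro divide_left_mono power_mono mult_pos_pos zero_less_power) auto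
        then have "F p \<le> k * (Gy p)\<^sup>2" unfolding F_def A_def[symmetric] by (intro mult_right_mono) auto
        moreover have "0 \<le> k * (Gx p)\<^sup>2" using A \<epsilon> by (simp add: k_def)
        ultimately show ?thesis using 2 by simp
      qed
      then have "J M (\<lambda>p. F p + err \<epsilon> p) \<le> J M (\<lambda>p. Xx p + Yy p)"
        unfolding J_def by (intro integral_le integrable_box continuous_intros cF cerr cXY \<epsilon>)
      moreover have "J M (\<lambda>p. F p + err \<epsilon> p) = J M F + J M (err \<epsilon>)"
        unfolding J_def by (intro integral_add integrable_box cF cerr \<epsilon>)
      ultimately show ?thesis using up by simp
    qed
    \<comment> \<open>Both v and \<open>(Gx, Gy)\<close> carry a factor \<open>a\<close> where s <
      0, so |err| \<le> 3 h a^3 \<epsilon> / (a + \<epsilon>)^4 \<le> 3 h, uniformly in \<epsilon>.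
      As \<open>err\<close> tends to 0 pointwise, dominated convergence removes it.\<close>
    have JF: "J M F \<le> K * integral {x..x + L} (\<lambda>t. \<bar>v (t, - M)\<bar>)" if M: "- M \<le> N" for M
    proof -
      define \<epsilon> where "\<epsilon> n = inverse (real (Suc n))" for n
      have \<epsilon>: "0 < \<epsilon> n" "\<epsilon> n \<le> 1" for n by (auto simp: \<epsilon>_def field_simps)
      have \<epsilon>0: "\<epsilon> \<longlonglongrightarrow> 0" unfolding \<epsilon>_def by (rule LIMSEQ_inverse_real_of_nat)
      define h where "h p = K1 * (\<bar>ux p\<bar> * (K + K1 * \<bar>ux p\<bar>) + \<bar>uy p\<bar> * (K + K1 * \<bar>uy p\<bar>))" for p
      have h0: "h p \<ge> 0" for p using K K1 by (auto simp: h_def intro!: mult_nonneg_nonneg add_nonneg_nonneg)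
      have "(\<lambda>n. J M (err (\<epsilon> n))) \<longlonglongrightarrow> integral (cbox (x, - M) (x + L, N)) (\<lambda>p. 0)"
        unfolding J_def
      proof (rule dominated_convergence(2))
        show "err (\<epsilon> n) integrable_on cbox (x, - M) (x + L, N)" for n
          by (intro integrable_box cerr \<epsilon>)
        show "(\<lambda>p. 3 * h p) integrable_on cbox (x, - M) (x + L, N)"
          unfolding h_def by (intro integrable_box ci)
        show "norm (err (\<epsilon> n) p) \<le> 3 * h p" for n p
        proof (cases "s p < 0")
          case True
          have "\<bar>ux p * Gx p + uy p * Gy p\<bar> \<le> \<bar>ux p\<bar> * \<bar>Gx p\<bar> + \<bar>uy p\<bar> * \<bar>Gy p\<bar>"
            unfolding abs_mult[symmetric] by linarith
          also have "\<dots> \<le> \<bar>ux p\<bar> * (a p * (K + K1 * \<bar>ux p\<bar>)) + \<bar>uy p\<bar> * (a p * (K + K1 * \<bar>uy p\<bar>))"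
            using G_le[OF True] by (intro add_mono mult_left_mono) auto
          finally have "\<bar>v p\<bar> * \<bar>ux p * Gx p + uy p * Gy p\<bar> \<le> K1 * a p *
             (\<bar>ux p\<bar> * (a p * (K + K1 * \<bar>ux p\<bar>)) + \<bar>uy p\<bar> * (a p * (K + K1 * \<bar>uy p\<bar>)))"
            using va_le[OF True] K1 a(1) by (intro mult_mono) auto
          also have "\<dots> = (a p)\<^sup>2 * h p" by (simp add: h_def power2_eq_square algebra_simps)
          finally have 1: "\<bar>v p * (ux p * Gx p + uy p * Gy p)\<bar> \<le> (a p)\<^sup>2 * h p" by (simp add: abs_mult)
          have coef: "0 \<le> 3 * a p * \<epsilon> n / (a p + \<epsilon> n)^4" using a(1)[of p] \<epsilon>(1)[of n] by simp
          have "norm (err (\<epsilon> n) p) = 3 * a p * \<epsilon> n / (a p + \<epsilon> n)^4 * \<bar>v p * (ux p * Gx p + uy p * Gy p)\<bar>"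
            unfolding err_def real_norm_def abs_mult[of "3 * a p * \<epsilon> n / (a p + \<epsilon> n)^4"]
              abs_of_nonneg[OF coef] by (rule refl)
          also have "\<dots> \<le> 3 * a p * \<epsilon> n / (a p + \<epsilon> n)^4 * ((a p)\<^sup>2 * h p)"
            using 1 coef by (rule mult_left_mono)
          also have "\<dots> = 3 * h p * ((a p)^3 * \<epsilon> n / (a p + \<epsilon> n)^4)"
            by (simp add: power2_eq_square power3_eq_cube)
          also have "\<dots> \<le> 3 * h p * 1"
          proof (intro mult_left_mono)
            have "(a p)^3 * \<epsilon> n \<le> (a p + \<epsilon> n)^3 * (a p + \<epsilon> n)"
              using a(1)[of p] \<epsilon>(1)[of n] by (intro mult_mono power_mono) auto
            then show "(a p)^3 * \<epsilon> n / (a p + \<epsilon> n)^4 \<le> 1"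
              using pos[OF \<epsilon>(1), of p n] by (simp add: power_numeral_reduce mult_ac)
          qed (use h0 in auto)
          finally show ?thesis by simp
        next
          case False
          then show ?thesis using a(3)[of p] h0 by (simp add: err_def)
        qed
        show "(\<lambda>n. err (\<epsilon> n) p) \<longlonglongrightarrow> 0" for p
        proof (cases "a p = 0")
          case False
          then show ?thesis unfolding err_def
            by (auto intro!: tendsto_eq_intros \<epsilon>0)
        qed (simp add: err_def)
      qed
      then have "(\<lambda>n. J M F + J M (err (\<epsilon> n))) \<longlonglongrightarrow> J M F + 0"
        by (intro tendsto_add tendsto_const) simp
      then have "J M F + 0 \<le> K * integral {x..x + L} (\<lambda>t. \<bar>v (t, - M)\<bar>)"
        by (rule LIMSEQ_le_const2) (use est \<epsilon> M in auto)
      then show ?thesis by simp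
    qed
    have "(\<lambda>n. integral {x..x + L} (\<lambda>t. \<bar>v (t, - real n)\<bar>)) \<longlonglongrightarrow> integral {x..x + L} (\<lambda>t. 0)"
    proof -
      have lim_n: "(\<lambda>n. v (t, - real n)) \<longlonglongrightarrow> 0" for t
      proof (rule filterlim_compose[OF lim[of t]])
        show "filterlim (\<lambda>n. - real n) at_bot sequentially"
          using filterlim_real_sequentially by (simp add: filterlim_uminus_at_bot)
      qed
      \<comment> \<open>The decay of v is only pointwise in x. A bound on one column, spread over
        the period by \<open>vx_le\<close>, gives the dominating constant.\<close>
      obtain B where B: "\<And>n. \<bar>v (x, - real n)\<bar> \<le> B"
        using convergentI[OF lim_n[of x], THEN convergent_imp_Bseq] by (auto simp: Bseq_def)
      show ?thesis
      proof (rule dominated_convergence(2))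
        show "(\<lambda>t. \<bar>v (t, - real n)\<bar>) integrable_on {x..x + L}" for n
          by (intro integrable_continuous_interval continuous_intros continuous_on_line cv0)
        show "(\<lambda>t. B + K * L) integrable_on {x..x + L}" by (rule integrable_const_ivl)
        fix n t assume t: "t \<in> {x..x + L}"
        have "\<bar>v (t, - real n) - v (x, - real n)\<bar> \<le> K * \<bar>t - x\<bar>"
          using field_differentiable_bound[of UNIV "\<lambda>t. v (t, - real n)" "\<lambda>t. vx (t, - real n)" K t x]
            has_gradD(1)[OF v] vx_le by simp
        also have "\<dots> \<le> K * L" using K t by (intro mult_left_mono) auto
        finally show "norm \<bar>v (t, - real n)\<bar> \<le> B + K * L" using B[of n] by simp
      next
        show "(\<lambda>n. \<bar>v (t, - real n)\<bar>) \<longlonglongrightarrow> 0" for t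
          using lim_n[of t] by (rule tendsto_rabs_zero)
      qed
    qed
    then have lim0: "(\<lambda>n. K * integral {x..x + L} (\<lambda>t. \<bar>v (t, - real n)\<bar>)) \<longlonglongrightarrow> 0"
      by (auto intro: tendsto_mult_right_zero)
    define m0 where "m0 = nat \<lceil>\<bar>y\<bar>\<rceil>"
    have m0: "- real m0 \<le> y" "- real m0 < N" using N(2) by (auto simp: m0_def) linarith+
    \<comment> \<open>\<open>F\<close> is nonnegative, so \<open>J M F\<close> grows with
      \<open>M\<close>, while the bottom flux that bounds it tends to 0.\<close>
    have "J (real m0) F \<le> 0"
    proof (rule LIMSEQ_le_const[OF lim0], intro exI allI impI)
      fix n assume "m0 \<le> n"
      then have "J (real m0) F \<le> J (real n) F"
        unfolding J_def using F0 by (intro integral_subset_le integrable_box cF) (auto simp: cbox_Pair_eq)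
      also have "\<dots> \<le> K * integral {x..x + L} (\<lambda>t. \<bar>v (t, - real n)\<bar>)"
        using \<open>m0 \<le> n\<close> m0(2) by (intro JF) linarith
      finally show "J (real m0) F \<le> K * integral {x..x + L} (\<lambda>t. \<bar>v (t, - real n)\<bar>)" .
    qed
    then have "F p = 0"
      unfolding J_def p using F0 L N m0
      by (intro integral_box_eq_0_imp[OF cF, where ?x0.0=x and a="- real m0" and ?x1.0="x + L" and b=N]) auto
    then show "Gy p = 0" using that pos[of 1 p] by (auto simp: F_def a_def)
  qed
  obtain x y where p: "p = (x, y)" by force
  \<comment> \<open>Vanishing \<open>Gy\<close> makes v / s constant on the vertical half-line below
    p, where |s| increases downwards. So |v| cannot decrease downwards, yet it tends to 0.\<close>
  have "\<bar>v (x, y)\<bar> \<le> \<bar>v (x, t)\<bar>" if t: "t < y" for t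
  proof -
    have neg: "s (x, z) \<le> s (x, y)" "s (x, z) < 0" if "z \<le> y" for z
    proof -
      have "0 \<le> C\<^sub>0 * (y - z)" using that C0 by simp
      then show "s (x, z) \<le> s (x, y)" "s (x, z) < 0"
        using u_incr[OF that, of x] below unfolding s_def p by linarith+
    qed
    have "\<exists>z>t. z < y \<and> v (x, y) / s (x, y) - v (x, t) / s (x, t) = (y - t) * (Gy (x, z) / (s (x, z))\<^sup>2)"
    proof (rule MVT2[OF t])
      fix z assume z: "t \<le> z" "z \<le> y"
      show "((\<lambda>z. v (x, z) / s (x, z)) has_real_derivative Gy (x, z) / (s (x, z))\<^sup>2) (at z)"
        unfolding s_def using neg(2)[OF z(2)]
        by (auto intro!: derivative_eq_intros has_gradD[OF u] has_gradD[OF v]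
            simp: s_def Gy_def power2_eq_square mult.commute)
    qed
    then have eq: "v (x, y) / s (x, y) = v (x, t) / s (x, t)"
      using Gy0 neg(2) by force
    have "\<bar>v (x, y)\<bar> = \<bar>s (x, y)\<bar> * \<bar>v (x, y) / s (x, y)\<bar>" using neg(2)[of y] by simp
    also have "\<dots> = \<bar>s (x, y)\<bar> * (\<bar>v (x, t)\<bar> / \<bar>s (x, t)\<bar>)" by (simp add: eq)
    also have "\<dots> \<le> \<bar>s (x, t)\<bar> * (\<bar>v (x, t)\<bar> / \<bar>s (x, t)\<bar>)"
      using neg[of t] neg[of y] t by (intro mult_right_mono divide_nonneg_nonneg) auto
    also have "\<dots> = \<bar>v (x, t)\<bar>" using neg(2)[of t] t by simp
    finally show ?thesis .
  qed
  then have "eventually (\<lambda>t. \<bar>v (x, y)\<bar> \<le> \<bar>v (x, t)\<bar>) at_bot"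
    using eventually_gt_at_bot eventually_at_bot_dense by blast
  then have "\<bar>v (x, y)\<bar> \<le> 0"
    using tendsto_rabs_zero[OF lim[of x]] by (intro tendsto_lowerbound[of _ 0 at_bot]) auto
  then show ?thesis by (simp add: p)
qed

subsection \<open>Traveling waves\<close>

text \<open>Incompressibility enters as |u_x| = |v_y| because the reflection in y that makes u
  increasing is applied without negating v: it preserves the vorticity equation but turns u_x + v_y
  = 0 into u_x = v_y.\<close>

lemma vanishes_if_no_inflection_on_critical_level:
  fixes u v :: "real \<times> real \<Rightarrow> real"
  assumes u: "has_grad u ux uy" and ux: "has_grad ux uxx uxy" and uy: "has_grad uy uyx uyy"
    and cu: "continuous_on UNIV uxx" "continuous_on UNIV uxy" "continuous_on UNIV uyy"
    and v: "has_grad v vx vy" and vx: "has_grad vx vxx vxy" and vy: "has_grad vy vyx vyy"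
    and cv: "continuous_on UNIV vxx" "continuous_on UNIV vxy" "continuous_on UNIV vyx" "continuous_on UNIV vyy"
    and per: "x_periodic L u" "x_periodic L v" and L: "L > 0"
    and eq: "\<And>p. (u p - c) * (vxx p + vyy p) + v p * (\<beta> - (uxx p + uyy p)) = 0" and \<beta>: "\<beta> \<ge> 0"
    and div: "\<And>p. \<bar>ux p\<bar> = \<bar>vy p\<bar>"
    and no_inflection: "\<And>p. u p = c \<Longrightarrow> \<beta> - (uxx p + uyy p) \<noteq> 0"
    and C0: "C\<^sub>0 > 0" and uy_ge: "\<And>p. C\<^sub>0 \<le> uy p"
    and vx_le: "\<And>p. \<bar>vx p\<bar> \<le> K" and vy_le: "\<And>p. \<bar>vy p\<bar> \<le> K"
    and lim: "\<And>x. ((\<lambda>y. v (x, y)) \<longlongrightarrow> 0) at_bot"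
  shows "v p = 0"
proof -
  have cuy: "continuous_on UNIV uy" and cvy: "continuous_on UNIV vy"
    using continuous_on_of_grad uy vy cu cv by blast+
  have cu0: "continuous_on UNIV u" and cv0: "continuous_on UNIV v"
    using continuous_on_of_grad u v cuy cvy by blast+
  have below: "v p = 0" if "u p < c" for p
  proof (rule vanishes_below_critical_level[OF u ux uy cu v vx vy cv(1,2,4) per L eq \<beta> C0 uy_ge _ vx_le vy_le lim that])
    show "v p = 0" if "u p = c" for p using eq[of p] no_inflection[of p] that by simp
  qed
  note u_incr = increment_ge[OF u uy_ge]
  have ux0: "ux (x, y) = 0" if "u (x, y) < c" for x y
  proof -
    have "open {t. u (x, t) < c}"
      by (intro open_Collect_less continuous_on_line cu0 continuous_on_const)
    then have ev: "eventually (\<lambda>t. v (x, t) = 0) (nhds y)"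
      using eventually_nhds_in_open[of "{t. u (x, t) < c}" y] that below by (auto elim!: eventually_mono)
    have "vy (x, y) = 0"
      using DERIV_unique[OF has_gradD(2)[OF v] DERIV_cong_ev[OF refl ev refl, THEN iffD2, OF DERIV_const]] .
    then show ?thesis using div[of "(x, y)"] by simp
  qed
  \<comment> \<open>Connectedness: the set of points of the horizontal line where u keeps its value
    is closed, and open because u_x vanishes wherever u < c.\<close>
  have flat: "u (x', y) = u (x, y)" if ux_less: "u (x, y) < c" for x x' y
  proof -
    define S where "S = {t. u (t, y) = u (x, y)}"
    have "closed S" unfolding S_def
      by (intro closed_Collect_eq continuous_on_line cu0 continuous_on_const)
    moreover have "open S"
    proof (rule openI)
      fix t assume t: "t \<in> S"
      have "open {t. u (t, y) < c}"
        by (intro open_Collect_less continuous_on_line cu0 continuous_on_const)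
      then obtain d where d: "d > 0" "ball t d \<subseteq> {t. u (t, y) < c}"
        using t ux_less openE[of "{t. u (t, y) < c}" t] by (auto simp: S_def)
      have "\<exists>k. \<forall>s\<in>ball t d. u (s, y) = k"
      proof (rule has_field_derivative_zero_constant)
        fix s assume "s \<in> ball t d"
        then have "ux (s, y) = 0" using d by (intro ux0) auto
        then show "((\<lambda>s. u (s, y)) has_field_derivative 0) (at s within ball t d)"
          using has_gradD(1)[OF u, of y s] by (simp add: has_field_derivative_at_within)
      qed simp
      then have "ball t d \<subseteq> S" using t d(1) by (force simp: S_def)
      then show "\<exists>e>0. ball t e \<subseteq> S" using d(1) by blast
    qed
    moreover have "x \<in> S" by (simp add: S_def)
    ultimately have "S = UNIV" using clopen[of S] by auto
    then show ?thesis by (auto simp: S_def)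
  qed
  define d where "d = \<bar>u (0, 0) - c\<bar> / C\<^sub>0"
  have d: "d \<ge> 0" "C\<^sub>0 * d = \<bar>u (0, 0) - c\<bar>" using C0 by (auto simp: d_def)
  have "\<exists>g. - d \<le> g \<and> g \<le> d \<and> u (0, g) = c"
  proof (rule IVT')
    show "u (0, - d) \<le> c" "c \<le> u (0, d)"
      using u_incr[of "- d" 0 0] u_incr[of 0 d 0] d by auto
  qed (use d in \<open>auto intro: continuous_on_line cu0\<close>)
  then obtain g where g: "u (0, g) = c" by blast
  \<comment> \<open>If u were below c somewhere at height g, \<open>flat\<close> would carry this
    over to x = 0, where u = c.\<close>
  have ug: "c \<le> u (x, g)" for x using flat[of x g 0] g by (cases "u (x, g) < c") auto
  have u_ge: "C\<^sub>0 * (y - g) \<le> u (x, y) - c" if "g \<le> y" for x y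
    using u_incr[OF that, of x] ug[of x] by simp
  have start_less: "v (x, y) = 0" if "y < g" for x y
  proof (rule below)
    have "0 < C\<^sub>0 * (g - y)" using that C0 by simp
    then have "u (0, y) < c" using u_incr[of y g 0] that g by linarith
    then show "u (x, y) < c" using flat[of 0 y x] by simp
  qed
  have start: "v (x, y) = 0" if "y \<le> g" for x y
    using that start_less eq_0_if_eq_0_left[OF cv0 start_less] by (cases "y = g") auto
  have vxy: "vxy = vyx"
    by (rule mixed_partials_eq[OF v has_gradD(2)[OF vx] has_gradD(1)[OF vy] cv(2,3)])
  have vy': "has_grad vy vxy vyy" using vy by (simp add: vxy)
  have "\<forall>x y. y \<le> g + real n / 2 \<longrightarrow> v (x, y) = 0" for n
  proof (induction n)
    case 0
    then show ?case using start by simp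
  next
    case (Suc n)
    define b where "b = g + real n / 2"
    have b: "b \<ge> g" by (simp add: b_def)
    have "v (x, y) = 0" if y: "y \<le> b + 1 / 2" for x y
    proof -
      \<comment> \<open>The bound is taken anew for each strip, as \<beta> - \<Delta>u is merely
        continuous and may be unbounded in y.\<close>
      have "bounded ((\<lambda>p. \<bar>\<beta> - (uxx p + uyy p)\<bar>) ` cbox (x, b) (x + L, b + 1))"
        by (intro compact_imp_bounded compact_continuous_image continuous_intros continuous_on_subset[OF cu(1)]
            continuous_on_subset[OF cu(3)] compact_cbox) auto
      then obtain B where B: "\<And>p. p \<in> cbox (x, b) (x + L, b + 1) \<Longrightarrow> \<bar>\<beta> - (uxx p + uyy p)\<bar> \<le> B"
        by (auto simp: bounded_iff simp del: cbox_Pair_eq)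
      show ?thesis
      proof (rule unique_continuation_strip[OF v vx vy' cv(1,2,4) per(2) L _ _ y])
        show "v (x, y) = 0" if "y \<le> b" for x y using Suc.IH that by (simp add: b_def)
        fix s y assume s: "s \<in> {x..x + L}" and y: "b < y" "y < b + 1"
        define p where "p = (s, y)"
        \<comment> \<open>Only the first strip touches the critical line. Measuring the distance
          from \<open>b\<close> instead of \<open>g\<close> weakens the bound later on, but gives
          every strip the same form.\<close>
        have up: "C\<^sub>0 * (y - b) \<le> u p - c"
        proof -
          have "C\<^sub>0 * (y - b) \<le> C\<^sub>0 * (y - g)" using b C0 by (intro mult_left_mono) auto
          then show ?thesis using u_ge[of y s] y b by (simp add: p_def)
        qed
        have "C\<^sub>0 * (y - b) \<ge> 0" using y C0 by simp
        have "C\<^sub>0 * (y - b) * \<bar>vxx p + vyy p\<bar> \<le> (u p - c) * \<bar>vxx p + vyy p\<bar>"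
          using up by (rule mult_right_mono) simp
        also have "\<dots> = \<bar>(u p - c) * (vxx p + vyy p)\<bar>"
          using up \<open>C\<^sub>0 * (y - b) \<ge> 0\<close> by (simp add: abs_mult)
        also have "\<dots> = \<bar>v p\<bar> * \<bar>\<beta> - (uxx p + uyy p)\<bar>"
          using eq[of p] by (metis abs_mult abs_minus_cancel add_eq_0_iff)
        also have "\<dots> \<le> \<bar>v p\<bar> * B"
          using s y by (intro mult_left_mono B) (auto simp: p_def)
        finally show "(y - b) * \<bar>vxx (s, y) + vyy (s, y)\<bar> \<le> B / C\<^sub>0 * \<bar>v (s, y)\<bar>"
          using C0 by (simp add: p_def field_simps)
      qed
    qed
    then show ?case by (simp add: b_def add_divide_distrib algebra_simps)
  qed
  moreover obtain n where "2 * (snd p - g) \<le> real n" using real_arch_simple by blast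
  ultimately show ?thesis by (cases p) (auto simp: field_simps)
qed

text \<open>At t = 0 the momentum equations identify the partials of the pressure with explicit
  functions whose mixed derivatives are continuous, so Schwarz's theorem applies. Incompressibility
  turns the derivatives of the vorticity v_x - u_y into \<Delta>v and - \<Delta>u.\<close>

lemma traveling_wave_vorticity:
  assumes "traveling_wave_solution L \<beta> c u v"
    and u: "has_grad u ux uy" and ux: "has_grad ux uxx uxy" and uy: "has_grad uy uyx uyy"
    and cu: "continuous_on UNIV uxx" "continuous_on UNIV uxy" "continuous_on UNIV uyx" "continuous_on UNIV uyy"
    and v: "has_grad v vx vy" and vx: "has_grad vx vxx vxy" and vy: "has_grad vy vyx vyy"
    and cv: "continuous_on UNIV vxx" "continuous_on UNIV vxy" "continuous_on UNIV vyx" "continuous_on UNIV vyy"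
  shows "ux p + vy p = 0"
    and "(u p - c) * (vxx p + vyy p) + v p * (\<beta> - (uxx p + uyy p)) = 0"
proof -
  obtain P where P: "beta_plane_solution L \<beta> (\<lambda>t (x, y). u (x - c * t, y)) (\<lambda>t (x, y). v (x - c * t, y)) P"
    using assms(1) by (auto simp: traveling_wave_solution_def)
  have dt: "deriv (\<lambda>s. w (x - c * s, y)) 0 = - c * wx (x, y)" if w: "has_grad w wx wy" for w wx wy x y
  proof (rule DERIV_imp_deriv)
    have 1: "((\<lambda>s. w (s, y)) has_real_derivative wx (x, y)) (at (x - c * 0))"
      using has_gradD(1)[OF w, of y x] by simp
    have 2: "((\<lambda>s. x - c * s) has_real_derivative - c) (at 0)"
      by (auto intro!: derivative_eq_intros)
    show "((\<lambda>s. w (x - c * s, y)) has_real_derivative - c * wx (x, y)) (at 0)"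
      using DERIV_chain2[where f="\<lambda>s. w (s, y)" and g="\<lambda>s. x - c * s", OF 1 2]
      by (simp add: mult.commute)
  qed
  have hp: "has_partials (P 0)" using P by (auto simp: beta_plane_solution_def)
  have eqs: "- c * ux (x, y) + u (x, y) * ux (x, y) + v (x, y) * uy (x, y) - \<beta> * y * v (x, y)
      = - partial_x (P 0) (x, y)"
    "- c * vx (x, y) + u (x, y) * vx (x, y) + v (x, y) * vy (x, y) + \<beta> * y * u (x, y)
      = - partial_y (P 0) (x, y)"
    "ux (x, y) + vy (x, y) = 0" for x y
    using P[unfolded beta_plane_solution_def, THEN conjunct2, THEN conjunct2, THEN conjunct2, THEN spec, of 0,
        THEN spec, THEN spec, of x y]
    by (simp_all add: dt[OF u] dt[OF v] partials_eqI[OF u] partials_eqI[OF v])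
  have div: "ux p + vy p = 0" for p using eqs(3)[of "fst p" "snd p"] by simp
  then show "ux p + vy p = 0" .
  have cont: "continuous_on UNIV u" "continuous_on UNIV ux" "continuous_on UNIV uy"
    "continuous_on UNIV v" "continuous_on UNIV vx" "continuous_on UNIV vy"
    using continuous_on_of_grad u ux uy v vx vy cu cv by metis+
  have uxy: "uxy (x, y) = - vyy (x, y)" for x y
  proof (rule DERIV_unique[OF has_gradD(2)[OF ux]])
    have "ux = (\<lambda>p. - vy p)" using div by (auto simp: eq_neg_iff_add_eq_0)
    then show "((\<lambda>s. ux (x, s)) has_real_derivative - vyy (x, y)) (at y)"
      using has_gradD(2)[OF vy, of x y] by (auto intro!: derivative_eq_intros)
  qed
  have vyx: "vyx (x, y) = - uxx (x, y)" for x y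
  proof (rule DERIV_unique[OF has_gradD(1)[OF vy]])
    have "vy = (\<lambda>p. - ux p)" using div by (auto simp: eq_neg_iff_add_eq_0 add.commute)
    then show "((\<lambda>s. vy (s, y)) has_real_derivative - uxx (x, y)) (at x)"
      using has_gradD(1)[OF ux, of y x] by (auto intro!: derivative_eq_intros)
  qed
  define Px where "Px = (\<lambda>(x, y). - ((u (x, y) - c) * ux (x, y) + v (x, y) * uy (x, y) - \<beta> * y * v (x, y)))"
  define Py where "Py = (\<lambda>(x, y). - ((u (x, y) - c) * vx (x, y) + v (x, y) * vy (x, y) + \<beta> * y * u (x, y)))"
  have "partial_x (P 0) = Px" "partial_y (P 0) = Py"
  proof -
    have "partial_x (P 0) (x, y) = Px (x, y)" "partial_y (P 0) (x, y) = Py (x, y)" for x y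
      using eqs(1,2)[of x y] by (simp_all add: Px_def Py_def algebra_simps)
    then show "partial_x (P 0) = Px" "partial_y (P 0) = Py" by auto
  qed
  then have grad: "has_grad (P 0) Px Py" using hp by (simp add: has_partials_iff)
  define Pxy where "Pxy p = - (uy p * ux p + (u p - c) * uxy p + vy p * uy p + v p * uyy p
    - \<beta> * v p - \<beta> * snd p * vy p)" for p
  define Pyx where "Pyx p = - (ux p * vx p + (u p - c) * vxx p + vx p * vy p + v p * vyx p
    + \<beta> * snd p * ux p)" for p
  have "Pxy = Pyx"
  proof (rule mixed_partials_eq[OF grad])
    show "((\<lambda>s. Px (x, s)) has_real_derivative Pxy (x, y)) (at y)" for x y
      unfolding Px_def Pxy_def
      by (auto intro!: derivative_eq_intros has_gradD[OF u] has_gradD[OF ux] has_gradD[OF uy] has_gradD[OF v]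
          simp: algebra_simps)
    show "((\<lambda>s. Py (s, y)) has_real_derivative Pyx (x, y)) (at x)" for x y
      unfolding Py_def Pyx_def
      by (auto intro!: derivative_eq_intros has_gradD[OF u] has_gradD[OF v] has_gradD[OF vx] has_gradD[OF vy]
          simp: algebra_simps)
    show "continuous_on UNIV Pxy" "continuous_on UNIV Pyx"
      unfolding Pxy_def Pyx_def by (intro continuous_intros cont cu cv)+
  qed
  then have "Pyx p - Pxy p = 0" by simp
  moreover have "uxy p = - vyy p" "vyx p = - uxx p" "ux p = - vy p"
    using uxy[of "fst p" "snd p"] vyx[of "fst p" "snd p"] div[of p] by auto
  ultimately show "(u p - c) * (vxx p + vyy p) + v p * (\<beta> - (uxx p + uyy p)) = 0"
    by (simp add: Pxy_def Pyx_def algebra_simps)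
qed

section \<open>Reflection in y and the sign of the shear\<close>

lemma has_grad_reflect:
  assumes "has_grad f fx fy"
  shows "has_grad (\<lambda>p. f (fst p, - snd p)) (\<lambda>p. fx (fst p, - snd p)) (\<lambda>p. - fy (fst p, - snd p))"
proof (rule has_gradI)
  fix x y
  show "((\<lambda>s. f (fst (s, y), - snd (s, y))) has_real_derivative fx (fst (x, y), - snd (x, y))) (at x)"
    using has_gradD(1)[OF assms] by simp
  have "((\<lambda>s. - s) has_real_derivative - 1) (at y)" by (auto intro!: derivative_eq_intros)
  from DERIV_chain2[OF has_gradD(2)[OF assms] this]
  show "((\<lambda>s. f (fst (x, s), - snd (x, s))) has_real_derivative - fy (fst (x, y), - snd (x, y))) (at y)"
    by simp
qed

lemma continuous_on_reflect:
  fixes f :: "real \<times> real \<Rightarrow> real"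
  assumes "continuous_on UNIV f"
  shows "continuous_on UNIV (\<lambda>p. f (fst p, - snd p))"
  by (rule continuous_on_compose2[OF assms]) (auto intro!: continuous_intros)

lemma nonvanishing_constant_sign:
  fixes f :: "real \<times> real \<Rightarrow> real"
  assumes "continuous_on UNIV f" "\<And>p. f p \<noteq> 0"
  shows "(\<forall>p. 0 < f p) \<or> (\<forall>p. f p < 0)"
proof (rule ccontr)
  assume "\<not> ?thesis"
  then obtain p q where "f p \<le> 0" "0 \<le> f q" by (auto simp: not_less)
  moreover have "connected (range f)" by (intro connected_continuous_image assms connected_UNIV)
  ultimately have "0 \<in> range f" using connected_contains_Icc[of "range f" "f p" "f q"] by auto
  then show False using assms(2) by auto
qed

theorem theorem4p3:
  fixes L \<beta> c C\<^sub>0 :: real and u v :: "real \<times> real \<Rightarrow> real"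
  assumes "L > 0" and "\<beta> \<ge> 0"
    and "C2_channel L u" and "C2_channel L v"
    and "traveling_wave_solution L \<beta> c u v"
    and "\<not> shear_flow v"
    and "vanishes_at_ends v"
    and "C\<^sub>0 > 0" and "\<And>p. \<bar>partial_y u p\<bar> \<ge> C\<^sub>0"
    and "bounded (range (partial_x v))" and "bounded (range (partial_y v))"
    and "vanishes_at_ends (\<lambda>p. (v p)\<^sup>2 * partial_y u p / u p)"
  shows "generalized_inflection_value \<beta> u c"
proof (rule ccontr)
  assume contra: "\<not> generalized_inflection_value \<beta> u c"
  have per: "x_periodic L u" "x_periodic L v" and
    C2: "C1_plane u" "C1_plane (partial_x u)" "C1_plane (partial_y u)"
      "C1_plane v" "C1_plane (partial_x v)" "C1_plane (partial_y v)"
    using assms(3,4) by (auto simp: C2_channel_def C2_plane_def)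
  note u = C1_planeD(1)[OF C2(1)] C1_planeD(1)[OF C2(2)] C1_planeD(1)[OF C2(3)]
  note cu = C1_planeD(2,3)[OF C2(2)] C1_planeD(2,3)[OF C2(3)]
  note v = C1_planeD(1)[OF C2(4)] C1_planeD(1)[OF C2(5)] C1_planeD(1)[OF C2(6)]
  note cv = C1_planeD(2,3)[OF C2(5)] C1_planeD(2,3)[OF C2(6)]
  note eqs = traveling_wave_vorticity[OF assms(5) u cu v cv]
  have div: "\<bar>partial_x u p\<bar> = \<bar>partial_y v p\<bar>" for p using eqs(1)[of p] by linarith
  have no_inflection: "\<beta> - (partial_x (partial_x u) p + partial_y (partial_y u) p) \<noteq> 0" if "u p = c" for p
    using contra that by (auto simp: generalized_inflection_value_def laplacian_def)
  obtain K1 K2 where "\<And>p. \<bar>partial_x v p\<bar> \<le> K1" "\<And>p. \<bar>partial_y v p\<bar> \<le> K2"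
    using assms(10,11) by (auto simp: bounded_iff)
  then have K: "\<bar>partial_x v p\<bar> \<le> max K1 K2" "\<bar>partial_y v p\<bar> \<le> max K1 K2" for p
    by (auto simp: le_max_iff_disj)
  have lim: "((\<lambda>y. v (x, y)) \<longlongrightarrow> 0) at_bot" "((\<lambda>y. v (x, y)) \<longlongrightarrow> 0) at_top" for x
    using assms(7) by (auto simp: vanishes_at_ends_def)
  have "partial_y u p \<noteq> 0" for p using assms(8) assms(9)[of p] by auto
  then consider "\<And>p. 0 < partial_y u p" | "\<And>p. partial_y u p < 0"
    using nonvanishing_constant_sign[OF C1_planeD(3)[OF C2(1)]] by blast
  then have "v p = 0" for p
  proof cases
    case 1
    then have pos: "C\<^sub>0 \<le> partial_y u p" for p using assms(9)[of p] by (simp add: abs_of_pos)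
    show ?thesis
      by (rule vanishes_if_no_inflection_on_critical_level[OF u cu(1,2,4) v cv per assms(1) eqs(2) assms(2)
            div _ assms(8) pos K lim(1)]) (rule no_inflection)
  next
    case 2
    have neg: "C\<^sub>0 \<le> - partial_y u p" for p using 2[of p] assms(9)[of p] by simp
    \<comment> \<open>The reflection negates first y-derivatives, so these enter through
      \<open>gmr\<close> and all other functions through \<open>gr\<close>. Decay at the upper end
      becomes decay at the lower end.\<close>
    define r where "r = (\<lambda>(f :: real \<times> real \<Rightarrow> real) p. f (fst p, - snd p))"
    have gr: "has_grad (r f) (r fx) (\<lambda>p. - r fy p)" if "has_grad f fx fy" for f fx fy
      using has_grad_reflect[OF that] by (simp add: r_def)
    have gmr: "has_grad (\<lambda>p. - r f p) (\<lambda>p. - r fx p) (r fy)" if "has_grad f fx fy" for f fx fy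
      using has_grad_minus[OF gr[OF that]] by simp
    have cr: "continuous_on UNIV (r f)" "continuous_on UNIV (\<lambda>p. - r f p)" if "continuous_on UNIV f" for f
      using continuous_on_reflect[OF that] by (auto simp: r_def intro!: continuous_intros)
    have "r v q = 0" for q
    proof (rule vanishes_if_no_inflection_on_critical_level[OF gr[OF u(1)] gr[OF u(2)] gmr[OF u(3)]
          cr(1)[OF cu(1)] cr(2)[OF cu(2)] cr(1)[OF cu(4)] gr[OF v(1)] gr[OF v(2)] gmr[OF v(3)]
          cr(1)[OF cv(1)] cr(2)[OF cv(2)] cr(2)[OF cv(3)] cr(1)[OF cv(4)] _ _ assms(1) _ assms(2) _ _ assms(8)])
      show "x_periodic L (r u)" "x_periodic L (r v)"
        using per by (auto intro!: x_periodicI simp: r_def periodicD)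
      show "((\<lambda>y. r v (x, y)) \<longlongrightarrow> 0) at_bot" for x
        using filterlim_compose[OF lim(2) filterlim_uminus_at_top_at_bot] by (simp add: r_def)
    qed (use eqs(2) div no_inflection neg K in \<open>auto simp: r_def\<close>)
    from this[of "(fst p, - snd p)"] show ?thesis by (simp add: r_def)
  qed
  then show False using assms(6) by (auto simp: shear_flow_def)
qed

end
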